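(* Round-mapping with integer parameter $s_0>1$ (defined in the context) can be implemented on a word RAM using $O(1)$ words of memory, so that $\mathtt{init}()$, $\mathtt{numBuckets}()$ and $\mathtt{findBucket}(u)$ each take $O(1)$ time in the worst case, and $\mathtt{newBucket}()$ and $\mathtt{freeBucket}()$ each take $O(s_0)$ time in the worst case.
   Context: Round-mapping with integer parameter $s_0>0$ is the following abstract data structure. Its state is an integer $s$ with $s_0 \le s \le 2s_0-1$ and a partition of the unit circumference $C$ (points identified with fractions $u\in[0,1)$, measured clockwise) into $m$ consecutive arcs, numbered $0,1,\dots,m-1$ clockwise starting at the point $u=0$, each arc being either \emph{long} (of length $\lambda/s$) or \emph{short} (of length $\lambda/(s+1)$), for a common $\lambda>0$ determined by the total length being $1$. The arcs are in one-to-one correspondence with bucket numbers, which form a permutation of $\{0,\dots,m-1\}$. Operations: $\mathtt{init}()$: divide $C$ into $s=s_0$ long arcs with bucket numbers $0,\dots,s_0-1$ in order, and set $m=s_0$. $\mathtt{numBuckets}()$: return $m$. $\mathtt{findBucket}(u)$ for $0\le u<1$: return the bucket number of the arc containing the point at clockwise fraction $u$ of $C$ (so $u=0$ hits arc $0$). $\mathtt{newBucket}()$: if all arcs are short, declare them all long and set $s:=s_0$ if $s=2s_0-1$, else $s:=s+1$ (arc lengths unchanged, $\lambda$ rescaled accordingly). Then, starting from arc $0$ and proceeding clockwise, take the first $s$ long arcs (these are consecutive) and replace them by $s+1$ short arcs covering the same total length: the first $s$ of these keep, in order, the bucket numbers of the replaced arcs, and the last one is a new arc with bucket number $m$; then $m:=m+1$.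 Return the bucket numbers of the replaced arcs. $\mathtt{freeBucket}()$: the exact inverse of the last $\mathtt{newBucket}()$: if all arcs are long, declare them all short and set $s:=2s_0-1$ if $s=s_0$, else $s:=s-1$; take the first $s+1$ short arcs in clockwise order, discard the last of them (which carries bucket number $m-1$) and make the first $s$ of them long, covering the same total length; $m:=m-1$; return the bucket numbers of the original $s+1$ short arcs.
   Formalization: freeBucket merges the last s+1 short arcs, those made by the last newBucket, not the first s+1 short arcs from arc 0: with several groups of short arcs the latter would neither invert newBucket nor discard bucket number m-1. *)

theory Defs
  imports Complex_Main "HOL-Library.Monad_Syntax"
begin

section \<open>Round-mapping\<close>

datatype kind = Long | Short

text \<open>
  The arcs are listed clockwise from the point 0; each carries its bucket number, and the number m
  of arcs is the length of the list. Lengths are not stored: the kinds and \<open>par\<close> (the integer s)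
  determine them, because the circumference is 1.
\<close>

record rm_state =
  par  :: nat
  arcs :: "(kind \<times> nat) list"

definition divisor :: "rm_state \<Rightarrow> kind \<Rightarrow> nat" where
  "divisor st k = (case k of Long \<Rightarrow> par st | Short \<Rightarrow> par st + 1)"

definition lam :: "rm_state \<Rightarrow> real" where
  "lam st = 1 / (\<Sum>a\<leftarrow>arcs st. 1 / real (divisor st (fst a)))"

definition arc_length :: "rm_state \<Rightarrow> nat \<Rightarrow> real" where
  "arc_length st i = lam st / real (divisor st (fst (arcs st ! i)))"

definition arc_start :: "rm_state \<Rightarrow> nat \<Rightarrow> real" where
  "arc_start st i = (\<Sum>j<i. arc_length st j)"

definition rm_init :: "nat \<Rightarrow> rm_state" where
  "rm_init s0 = \<lparr>par = s0, arcs = map (\<lambda>i. (Long, i)) [0..<s0]\<rparr>"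

definition num_buckets :: "rm_state \<Rightarrow> nat" where
  "num_buckets st = length (arcs st)"

definition find_bucket :: "rm_state \<Rightarrow> real \<Rightarrow> nat" where
  "find_bucket st u =
     snd (arcs st ! (THE i. i < length (arcs st) \<and> arc_start st i \<le> u \<and> u < arc_start st (Suc i)))"

definition all_kind :: "kind \<Rightarrow> rm_state \<Rightarrow> bool" where
  "all_kind k st \<longleftrightarrow> (\<forall>a\<in>set (arcs st). fst a = k)"

definition set_kind :: "kind \<Rightarrow> (kind \<times> nat) list \<Rightarrow> (kind \<times> nat) list" where
  "set_kind k as = map (\<lambda>a. (k, snd a)) as"

definition short_to_long :: "nat \<Rightarrow> rm_state \<Rightarrow> rm_state" where
  "short_to_long s0 st =
     (if all_kind Short st
      then \<lparr>par = (if par st = 2 * s0 - 1 then s0 else par st + 1), arcs = set_kind Long (arcs st)\<rparr>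
      else st)"

definition long_to_short :: "nat \<Rightarrow> rm_state \<Rightarrow> rm_state" where
  "long_to_short s0 st =
     (if all_kind Long st
      then \<lparr>par = (if par st = s0 then 2 * s0 - 1 else par st - 1), arcs = set_kind Short (arcs st)\<rparr>
      else st)"

text \<open>
  In every reachable state the short arcs precede the long ones. Hence \<open>p\<close> below, the length of the
  initial run of short arcs, is where the first s long arcs begin and where the s+1 short arcs made
  by the last \<open>new_bucket\<close> end. Both operations return the bucket numbers in clockwise order,
  together with the new state.
\<close>

definition new_bucket :: "nat \<Rightarrow> rm_state \<Rightarrow> nat list \<times> rm_state" where
  "new_bucket s0 st0 =
     (let st = short_to_long s0 st0; s = par st; as = arcs st;
          p = length (takeWhile (\<lambda>a. fst a = Short) as);
          replaced = take s (drop p as)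
      in (map snd replaced,
          \<lparr>par = s,
           arcs = take p as @ set_kind Short replaced @ [(Short, length as)] @ drop (p + s) as\<rparr>))"

definition free_bucket :: "nat \<Rightarrow> rm_state \<Rightarrow> nat list \<times> rm_state" where
  "free_bucket s0 st0 =
     (let st = long_to_short s0 st0; s = par st; as = arcs st;
          p = length (takeWhile (\<lambda>a. fst a = Short) as);
          merged = take (s + 1) (drop (p - (s + 1)) as)
      in (map snd merged,
          \<lparr>par = s,
           arcs = take (p - (s + 1)) as @ set_kind Long (take s merged) @ drop p as\<rparr>))"

text \<open>
  \<open>free_bucket\<close> undoes \<open>new_bucket\<close>, and the arc it discards carries the largest bucket number.
  A state whose arcs are all short comes back redeclared as all long, which is the same partition.
\<close>

lemma free_bucket_new_bucket:
  assumes st: "arcs (short_to_long s0 st) = A @ B"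
    and A: "\<forall>a\<in>set A. fst a = Short" and B: "\<forall>a\<in>set B. fst a = Long"
    and s: "0 < par (short_to_long s0 st)" "par (short_to_long s0 st) \<le> length B"
  shows "free_bucket s0 (snd (new_bucket s0 st)) =
           (fst (new_bucket s0 st) @ [num_buckets st], short_to_long s0 st)"
proof -
  define s where "s = par (short_to_long s0 st)"
  define B1 where "B1 = take s B"
  define B2 where "B2 = drop s B"
  have B12: "B = B1 @ B2" "length B1 = s"
    using s by (auto simp: B1_def B2_def s_def)
  have sk: "set_kind k (set_kind k' xs) = set_kind k xs" "map snd (set_kind k xs) = map snd xs"
    "length (set_kind k xs) = length xs" for k k' xs
    by (simp_all add: set_kind_def)
  have skL: "set_kind Long B1 = B1"
    unfolding set_kind_def by (rule map_idI) (use B B12 in \<open>force intro: prod_eqI\<close>)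
  have len: "length (A @ B) = num_buckets st"
    unfolding st[symmetric] by (simp add: short_to_long_def num_buckets_def set_kind_def)
  have B_ne: "B \<noteq> []"
    using s by auto
  have tw: "takeWhile (\<lambda>a. fst a = Short) (A @ B) = A"
  proof -
    have "takeWhile (\<lambda>a. fst a = Short) B = []"
      using B B_ne by (cases B) auto
    then show ?thesis
      using A by (simp add: takeWhile_append)
  qed
  define C where "C = A @ set_kind Short B1 @ [(Short, num_buckets st)]"
  have new: "new_bucket s0 st = (map snd B1, \<lparr>par = s, arcs = C @ B2\<rparr>)"
    unfolding new_bucket_def Let_def st tw s_def[symmetric] len
    using B12 by (simp add: C_def)
  have C: "\<forall>a\<in>set C. fst a = Short"
    using A by (auto simp: C_def set_kind_def)
  have twC: "takeWhile (\<lambda>a. fst a = Short) (C @ B2) = C"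
  proof -
    have "takeWhile (\<lambda>a. fst a = Short) B2 = []"
      using B B12 by (cases B2) auto
    then show ?thesis
      using C by (simp add: takeWhile_append)
  qed
  have "\<not> all_kind Long \<lparr>par = s, arcs = C @ B2\<rparr>"
    by (auto simp: all_kind_def C_def)
  then have ls: "long_to_short s0 \<lparr>par = s, arcs = C @ B2\<rparr> = \<lparr>par = s, arcs = C @ B2\<rparr>"
    by (simp add: long_to_short_def)
  have "length C - (s + 1) = length A"
    using B12 by (simp add: C_def sk)
  then have "free_bucket s0 \<lparr>par = s, arcs = C @ B2\<rparr> =
      (map snd B1 @ [num_buckets st], \<lparr>par = s, arcs = A @ B1 @ B2\<rparr>)"
    unfolding free_bucket_def Let_def ls rm_state.simps twC
    using B12 by (simp add: C_def sk skL)
  moreover have "short_to_long s0 st = \<lparr>par = s, arcs = A @ B1 @ B2\<rparr>"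
    using st B12 by (simp add: s_def)
  ultimately show ?thesis
    by (simp add: new)
qed


section \<open>A word RAM\<close>

text \<open>
  Memory is a list of words, i.e. of naturals below \<open>2 ^ w\<close> for the word size \<open>w\<close>. The length of
  this list is the space available to a program: an access beyond its end is a fault, and so are
  reading past the end of the input and a quotient that does not fit into a word. All operands are
  direct addresses, except that \<open>Load\<close> and \<open>Store\<close> address indirectly. As usual in hardware, a
  product is delivered as a double word (high and low part), and the dividend is a double word.
  Input is read-only and output write-only; neither counts as memory.
\<close>

datatype alu = Add | Sub | And | Or | Xor | Shl | Shr

datatype instr =
    Const nat nat
  | Alu alu nat nat nat
  | Mul nat nat nat nat
  | Div nat nat nat nat nat
  | Load nat nat
  | Store nat nat
  | Jump nat
  | Jump_zero nat nat
  | Jump_less nat nat nat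
  | Read nat
  | Write nat
  | Halt

fun alu_sem :: "nat \<Rightarrow> alu \<Rightarrow> nat \<Rightarrow> nat \<Rightarrow> nat" where
  "alu_sem w Add x y = (x + y) mod 2 ^ w"
| "alu_sem w Sub x y = (x + 2 ^ w - y) mod 2 ^ w"
| "alu_sem w And x y = Bit_Operations.and x y"
| "alu_sem w Or x y = Bit_Operations.or x y"
| "alu_sem w Xor x y = Bit_Operations.xor x y"
| "alu_sem w Shl x y = push_bit y x mod 2 ^ w"
| "alu_sem w Shr x y = drop_bit y x"

record config =
  pc  :: nat
  mem :: "nat list"
  inp :: "nat list"
  out :: "nat list"

definition get :: "nat list \<Rightarrow> nat \<Rightarrow> nat option" where
  "get m a = (if a < length m then Some (m ! a) else None)"

definition put :: "nat list \<Rightarrow> nat \<Rightarrow> nat \<Rightarrow> nat list option" where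
  "put m a x = (if a < length m then Some (m[a := x]) else None)"

definition next_mem :: "config \<Rightarrow> nat list \<Rightarrow> config" where
  "next_mem c m = c\<lparr>pc := Suc (pc c), mem := m\<rparr>"

fun step :: "nat \<Rightarrow> instr \<Rightarrow> config \<Rightarrow> config option" where
  "step w (Const d n) c = do {
     m \<leftarrow> put (mem c) d (n mod 2 ^ w);
     Some (next_mem c m) }"
| "step w (Alu f d a b) c = do {
     x \<leftarrow> get (mem c) a;
     y \<leftarrow> get (mem c) b;
     m \<leftarrow> put (mem c) d (alu_sem w f x y);
     Some (next_mem c m) }"
| "step w (Mul h l a b) c = do {
     x \<leftarrow> get (mem c) a;
     y \<leftarrow> get (mem c) b;
     m \<leftarrow> put (mem c) h (x * y div 2 ^ w);
     m' \<leftarrow> put m l (x * y mod 2 ^ w);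
     Some (next_mem c m') }"
| "step w (Div q r h l b) c = do {
     x \<leftarrow> get (mem c) h;
     y \<leftarrow> get (mem c) l;
     z \<leftarrow> get (mem c) b;
     if x < z then do {
       m \<leftarrow> put (mem c) q ((x * 2 ^ w + y) div z);
       m' \<leftarrow> put m r ((x * 2 ^ w + y) mod z);
       Some (next_mem c m') }
     else None }"
| "step w (Load d a) c = do {
     p \<leftarrow> get (mem c) a;
     x \<leftarrow> get (mem c) p;
     m \<leftarrow> put (mem c) d x;
     Some (next_mem c m) }"
| "step w (Store a b) c = do {
     p \<leftarrow> get (mem c) a;
     x \<leftarrow> get (mem c) b;
     m \<leftarrow> put (mem c) p x;
     Some (next_mem c m) }"
| "step w (Jump l) c = Some (c\<lparr>pc := l\<rparr>)"
| "step w (Jump_zero a l) c = do {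
     x \<leftarrow> get (mem c) a;
     Some (c\<lparr>pc := if x = 0 then l else Suc (pc c)\<rparr>) }"
| "step w (Jump_less a b l) c = do {
     x \<leftarrow> get (mem c) a;
     y \<leftarrow> get (mem c) b;
     Some (c\<lparr>pc := if x < y then l else Suc (pc c)\<rparr>) }"
| "step w (Read d) c = (case inp c of
     [] \<Rightarrow> None
   | x # xs \<Rightarrow> do {
       m \<leftarrow> put (mem c) d x;
       Some (next_mem c m\<lparr>inp := xs\<rparr>) })"
| "step w (Write a) c = do {
     x \<leftarrow> get (mem c) a;
     Some (c\<lparr>pc := Suc (pc c), out := out c @ [x]\<rparr>) }"
| "step w Halt c = None"

text \<open>\<open>exec w P c t c'\<close>: from \<open>c\<close>, program \<open>P\<close> halts in \<open>c'\<close> after exactly \<open>t\<close> instructions.\<close>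

inductive exec :: "nat \<Rightarrow> instr list \<Rightarrow> config \<Rightarrow> nat \<Rightarrow> config \<Rightarrow> bool" for w P where
  exec_halt: "pc c < length P \<Longrightarrow> P ! pc c = Halt \<Longrightarrow> exec w P c 1 c"
| exec_step: "pc c < length P \<Longrightarrow> step w (P ! pc c) c = Some c' \<Longrightarrow> exec w P c' t c'' \<Longrightarrow>
    exec w P c (Suc t) c''"

definition computes ::
  "nat \<Rightarrow> instr list \<Rightarrow> nat list \<Rightarrow> nat list \<Rightarrow> nat \<Rightarrow> nat list \<Rightarrow> nat list \<Rightarrow> bool" where
  "computes w P m xs t m' ys \<longleftrightarrow>
     (\<exists>c. exec w P \<lparr>pc = 0, mem = m, inp = xs, out = []\<rparr> t c \<and> mem c = m' \<and> out c = ys)"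


section \<open>Implementations of round-mapping\<close>

text \<open>The point of a \<open>Find_Bucket a b\<close> query is the fraction a/b, passed as two words.\<close>

datatype rm_op = Num_Buckets | Find_Bucket nat nat | New_Bucket | Free_Bucket

text \<open>
  Besides the points u outside of [0,1) and \<open>free_bucket\<close> without a \<open>new_bucket\<close> to undo, this
  excludes only what has no representation in words of size \<open>w\<close>: the number of buckets, and the two
  components of a query, must be below \<open>2 ^ w\<close>.
\<close>

fun admissible :: "nat \<Rightarrow> nat \<Rightarrow> rm_op \<Rightarrow> rm_state \<Rightarrow> bool" where
  "admissible w s0 Num_Buckets st = True"
| "admissible w s0 (Find_Bucket a b) st = (a < b \<and> b < 2 ^ w)"
| "admissible w s0 New_Bucket st = (num_buckets st + 1 < 2 ^ w)"
| "admissible w s0 Free_Bucket st = (s0 < num_buckets st)"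

fun args :: "rm_op \<Rightarrow> nat list" where
  "args (Find_Bucket a b) = [a, b]"
| "args _ = []"

fun result :: "nat \<Rightarrow> rm_op \<Rightarrow> rm_state \<Rightarrow> nat list" where
  "result s0 Num_Buckets st = [num_buckets st]"
| "result s0 (Find_Bucket a b) st = [find_bucket st (real a / real b)]"
| "result s0 New_Bucket st = fst (new_bucket s0 st)"
| "result s0 Free_Bucket st = fst (free_bucket s0 st)"

fun next_state :: "nat \<Rightarrow> rm_op \<Rightarrow> rm_state \<Rightarrow> rm_state" where
  "next_state s0 New_Bucket st = snd (new_bucket s0 st)"
| "next_state s0 Free_Bucket st = snd (free_bucket s0 st)"
| "next_state s0 _ st = st"

record rm_impl =
  init_prog :: "instr list"
  num_prog  :: "instr list"
  find_prog :: "instr list"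
  new_prog  :: "instr list"
  free_prog :: "instr list"

fun prog_of :: "rm_impl \<Rightarrow> rm_op \<Rightarrow> instr list" where
  "prog_of I Num_Buckets = num_prog I"
| "prog_of I (Find_Bucket a b) = find_prog I"
| "prog_of I New_Bucket = new_prog I"
| "prog_of I Free_Bucket = free_prog I"

fun time_bound :: "nat \<Rightarrow> nat \<Rightarrow> rm_op \<Rightarrow> nat" where
  "time_bound c s0 Num_Buckets = c"
| "time_bound c s0 (Find_Bucket a b) = c"
| "time_bound c s0 New_Bucket = c * s0"
| "time_bound c s0 Free_Bucket = c * s0"

text \<open>
  \<open>serves I w s0 c m st ops\<close>: started with memory \<open>m\<close> while the abstract state is \<open>st\<close>, the programs
  answer the operations \<open>ops\<close> correctly and in time, each one working on the memory left by the
  previous one, as long as the operations are admissible.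
\<close>

fun serves :: "rm_impl \<Rightarrow> nat \<Rightarrow> nat \<Rightarrow> nat \<Rightarrow> nat list \<Rightarrow> rm_state \<Rightarrow> rm_op list \<Rightarrow> bool" where
  "serves I w s0 c m st [] = True"
| "serves I w s0 c m st (x # ops) =
     (admissible w s0 x st \<longrightarrow>
        (\<exists>t m'. t \<le> time_bound c s0 x \<and>
           computes w (prog_of I x) m (args x) t m' (result s0 x st) \<and>
           serves I w s0 c m' (next_state s0 x st) ops))"

end

theory Submission
  imports Defs
begin

text \<open>
  Every reachable state consists of \<open>2 ^ k\<close> groups of arcs, each covering \<open>1 / 2 ^ k\<close> of the
  circumference: the first \<open>j\<close> groups have \<open>s + 1\<close> short arcs, the others \<open>s\<close> long ones. A new bucket
  turns group \<open>j\<close> from long to short; when \<open>s\<close> would reach \<open>2 * s0\<close>, every group is cut into two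
  groups of \<open>s0\<close> arcs. The bucket number of arc \<open>r\<close> in group \<open>g\<close> depends on \<open>k\<close>, \<open>g\<close>, \<open>r\<close> only: if
  \<open>r < s0\<close> and \<open>g = 2 ^ t * (2 * h + 1)\<close>, the arc was created when there were \<open>2 ^ (k - t - 1)\<close> groups,
  as arc \<open>s0 + r\<close> of group \<open>h\<close>. As \<open>2 ^ k\<close> is kept in memory and \<open>2 ^ (t + 1)\<close> is obtained from
  \<open>g xor (g - 1)\<close>, this number takes constantly many instructions. None of them overflows, since
  every intermediate result is bounded by the number of buckets. A point is located by two divisions
  of a double word, one for the group and one for the arc in it.
\<close>

section \<open>Bucket numbers\<close>

text \<open>The recursion undoes one doubling of the groups: group \<open>h\<close> with
  \<open>2 * s0\<close> arcs was cut into group \<open>2 * h\<close>, which keeps arcs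
  \<open>0\<close> to \<open>s0 - 1\<close>, and group \<open>2 * h + 1\<close>, which gets arcs
  \<open>s0 + r\<close>. An arc with \<open>s0 \<le> r\<close> was appended to its group
  \<open>g\<close> when \<open>r * 2 ^ Suc k + g\<close> buckets existed.\<close>

fun bucket :: "nat \<Rightarrow> nat \<Rightarrow> nat \<Rightarrow> nat \<Rightarrow> nat" where
  "bucket s0 0 g r = r"
| "bucket s0 (Suc k) g r =
     (if s0 \<le> r then r * 2 ^ Suc k + g
      else if odd g then (s0 + r) * 2 ^ k + g div 2
      else bucket s0 k (g div 2) r)"

lemma bucket_ge: "s0 \<le> r \<Longrightarrow> g < 2 ^ k \<Longrightarrow> bucket s0 k g r = r * 2 ^ k + g"
  by (cases k) auto

lemma bucket_zero: "r < s0 \<Longrightarrow> bucket s0 k 0 r = r"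
  by (induction k) auto

lemma div2_less_power: "(g::nat) < 2 ^ Suc k \<Longrightarrow> g div 2 < 2 ^ k"
  by auto

text \<open>Keeps bucket numbers within a word. For \<open>r < s0\<close> the induction gives the
  sharper bound \<open>s0 * 2 ^ k\<close>: an odd group contributes a number below
  \<open>(s0 + r + 1) * 2 ^ k\<close>, and \<open>s0 + r + 1 \<le> 2 * s0\<close>.\<close>

lemma bucket_less:
  assumes "g < 2 ^ k" "r < s" "s0 \<le> s"
  shows "bucket s0 k g r < s * 2 ^ k"
proof (cases "s0 \<le> r")
  case True
  have "r * 2 ^ k + g < Suc r * 2 ^ k"
    using assms(1) by simp
  also have "\<dots> \<le> s * 2 ^ k"
    using assms(2) by (intro mult_right_mono) auto
  finally show ?thesis
    using True assms by (simp add: bucket_ge)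
next
  case False
  then have "r < s0" by simp
  have "bucket s0 k g r < s0 * 2 ^ k"
    using assms(1)
  proof (induction k arbitrary: g)
    case 0
    then show ?case using \<open>r < s0\<close> by simp
  next
    case (Suc k)
    have "(s0 + r) * 2 ^ k + g div 2 < Suc (s0 + r) * 2 ^ k"
      using div2_less_power[OF Suc.prems] by simp
    also have "\<dots> \<le> (2 * s0) * 2 ^ k"
      using \<open>r < s0\<close> by (intro mult_right_mono) auto
    finally have 1: "(s0 + r) * 2 ^ k + g div 2 < s0 * 2 ^ Suc k"
      by simp
    have 2: "bucket s0 k (g div 2) r < s0 * 2 ^ Suc k"
      using Suc.IH[OF div2_less_power[OF Suc.prems]] by simp
    show ?case
      using 1 2 \<open>r < s0\<close> by simp
  qed
  also have "\<dots> \<le> s * 2 ^ k"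
    using assms(3) by simp
  finally show ?thesis .
qed

text \<open>For \<open>g > 0\<close> this is twice the largest power of 2 dividing \<open>g\<close>.\<close>

definition ruler :: "nat \<Rightarrow> nat" where
  "ruler g = Bit_Operations.xor (g - 1) g + 1"

lemma ruler_odd: "odd g \<Longrightarrow> ruler g = 2"
  by (elim oddE) (simp add: ruler_def xor_rec)

text \<open>\<open>2 * g - 1\<close> and \<open>2 * g\<close> differ in the lowest bit, and their
  higher bits are those of \<open>g - 1\<close> and \<open>g\<close>. So the xor is doubled plus 1,
  and the final \<open>+ 1\<close> of \<open>ruler\<close> turns this into exact doubling.\<close>

lemma ruler_double:
  assumes "0 < g"
  shows "ruler (2 * g) = 2 * ruler g"
proof -
  obtain h where h: "g = Suc h"
    using assms gr0_conv_Suc by auto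
  have "Bit_Operations.xor (2 * h + 1) (2 * g) = 2 * Bit_Operations.xor h g + 1"
    by (subst xor_rec) simp
  moreover have "2 * g - 1 = 2 * h + 1"
    using h by simp
  ultimately show ?thesis
    using h by (simp add: ruler_def)
qed

lemma ruler_le: "0 < g \<Longrightarrow> g < 2 ^ k \<Longrightarrow> ruler g \<le> 2 ^ k"
proof (induction k arbitrary: g)
  case (Suc k)
  show ?case
  proof (cases "odd g")
    case True
    then show ?thesis by (simp add: ruler_odd)
  next
    case False
    then obtain h where h: "g = 2 * h" by blast
    then show ?thesis
      using Suc by (simp add: ruler_double)
  qed
qed simp

text \<open>Replaces the recursion by two divisions. Halving an even \<open>g\<close> halves
  \<open>2 ^ k\<close> and \<open>ruler g\<close> as well, so both quotients persist down to the odd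
  case, where \<open>ruler g = 2\<close>.\<close>

lemma bucket_ruler:
  assumes "0 < g" "g < 2 ^ k" "r < s0"
  shows "bucket s0 k g r = (s0 + r) * (2 ^ k div ruler g) + g div ruler g"
  using assms(1,2)
proof (induction k arbitrary: g)
  case (Suc k)
  show ?case
  proof (cases "odd g")
    case True
    then show ?thesis using assms(3) by (simp add: ruler_odd)
  next
    case False
    then obtain h where h: "g = 2 * h" by blast
    then show ?thesis
      using Suc assms(3) by (simp add: ruler_double)
  qed
qed simp

section \<open>Reachable states\<close>

definition arc_group :: "nat \<Rightarrow> nat \<Rightarrow> kind \<Rightarrow> nat \<Rightarrow> nat \<Rightarrow> (kind \<times> nat) list" where
  "arc_group s0 k c n g = map (\<lambda>r. (c, bucket s0 k g r)) [0..<n]"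

text \<open>Both \<open>j = 0\<close> (all long) and \<open>j = 2 ^ k\<close> (all short) occur.
  They stay separate states because kinds are redeclared only when the next operation needs
  it.\<close>

definition canon :: "nat \<Rightarrow> nat \<Rightarrow> nat \<Rightarrow> nat \<Rightarrow> rm_state" where
  "canon s0 k s j =
     \<lparr>par = s,
      arcs = concat (map (arc_group s0 k Short (s + 1)) [0..<j]) @
             concat (map (arc_group s0 k Long s) [j..<2 ^ k])\<rparr>"

lemma length_group [simp]: "length (arc_group s0 k c n g) = n"
  by (simp add: arc_group_def)

lemma length_concat_groups [simp]:
  "length (concat (map (arc_group s0 k c n) xs)) = length xs * n"
  by (induction xs) auto

lemma fst_concat_groups: "a \<in> set (concat (map (arc_group s0 k c n) xs)) \<Longrightarrow> fst a = c"
  by (auto simp: arc_group_def)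

lemma set_kind_group: "set_kind c' (arc_group s0 k c n g) = arc_group s0 k c' n g"
  by (simp add: set_kind_def arc_group_def)

lemma set_kind_concat_groups:
  "set_kind c' (concat (map (arc_group s0 k c n) xs)) = concat (map (arc_group s0 k c' n) xs)"
  by (induction xs) (auto simp: set_kind_def arc_group_def)

lemma num_buckets_canon: "j \<le> 2 ^ k \<Longrightarrow> num_buckets (canon s0 k s j) = s * 2 ^ k + j"
  by (simp add: num_buckets_def canon_def algebra_simps)

lemma canon_init: "canon s0 0 s0 0 = rm_init s0"
  by (simp add: canon_def rm_init_def arc_group_def)

section \<open>Doubling the number of groups, and the two updates on canonical states\<close>

lemma concat_map_upt_double:
  "concat (map f [0..<2 * n]) = concat (map (\<lambda>i. f (2 * i) @ f (2 * i + 1)) [0..<n])"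
  by (induction n) auto

text \<open>Arcs below \<open>s0\<close> go to group \<open>2 * g\<close> by the even case of
  \<open>bucket\<close>; arc \<open>s0 + r\<close> has number \<open>(s0 + r) * 2 ^ k + g\<close> on
  both sides.\<close>

lemma arc_group_split:
  assumes "g < 2 ^ k"
  shows "arc_group s0 k c (2 * s0) g = arc_group s0 (Suc k) c s0 (2 * g) @ arc_group s0 (Suc k) c s0 (2 * g + 1)"
proof (rule nth_equalityI)
  fix i assume "i < length (arc_group s0 k c (2 * s0) g)"
  then have "i < 2 * s0" by simp
  then show "arc_group s0 k c (2 * s0) g ! i =
      (arc_group s0 (Suc k) c s0 (2 * g) @ arc_group s0 (Suc k) c s0 (2 * g + 1)) ! i"
    using assms by (auto simp: arc_group_def nth_append bucket_ge)
qed simp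

lemma concat_groups_split:
  "concat (map (arc_group s0 k c (2 * s0)) [0..<2 ^ k]) = concat (map (arc_group s0 (Suc k) c s0) [0..<2 ^ Suc k])"
  unfolding power_Suc concat_map_upt_double
  by (intro arg_cong[where f = concat] map_cong refl arc_group_split) simp

lemma short_to_long_canon_less:
  assumes "j < 2 ^ k" "0 < s"
  shows "short_to_long s0 (canon s0 k s j) = canon s0 k s j"
proof -
  have "(Long, bucket s0 k j 0) \<in> set (arcs (canon s0 k s j))"
    using assms by (force simp: canon_def arc_group_def)
  then have "\<not> all_kind Short (canon s0 k s j)"
    by (force simp: all_kind_def)
  then show ?thesis by (simp add: short_to_long_def)
qed

text \<open>Short groups have \<open>s + 1\<close> arcs, so redeclaring them raises \<open>s\<close>
  by one with the same groups. When \<open>s + 1 = 2 * s0\<close>, they split instead.\<close>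

lemma short_to_long_canon_all:
  assumes "0 < s0"
  shows "short_to_long s0 (canon s0 k s (2 ^ k)) =
    (if s = 2 * s0 - 1 then canon s0 (Suc k) s0 0 else canon s0 k (s + 1) 0)"
proof -
  have "all_kind Short (canon s0 k s (2 ^ k))"
    by (auto simp: all_kind_def canon_def arc_group_def)
  moreover have "Suc (2 * s0 - 1) = 2 * s0"
    using assms by simp
  ultimately show ?thesis
    using concat_groups_split[of s0 k Long]
    by (auto simp: short_to_long_def canon_def set_kind_concat_groups)
qed

text \<open>Assuming the outcome of \<open>short_to_long\<close> lets one proof cover states that
  get redeclared and states that do not.\<close>

lemma new_bucket_canon:
  assumes "short_to_long s0 st = canon s0 k s j" "j < 2 ^ k" "s0 \<le> s" "0 < s0"
  shows "new_bucket s0 st = (map (bucket s0 k j) [0..<s], canon s0 k s (Suc j))"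
proof -
  define A where "A = concat (map (arc_group s0 k Short (s + 1)) [0..<j])"
  define B where "B = concat (map (arc_group s0 k Long s) [Suc j..<2 ^ k])"
  have as: "arcs (canon s0 k s j) = A @ arc_group s0 k Long s j @ B"
    using assms(2) by (simp add: canon_def A_def B_def upt_conv_Cons)
  have pre: "par (canon s0 k s j) = s"
    by (simp add: canon_def)
  have "takeWhile (\<lambda>a. fst a = Short) (arc_group s0 k Long s j @ B) = []"
    using assms(3,4) by (simp add: arc_group_def upt_conv_Cons)
  moreover have "\<forall>a\<in>set A. fst a = Short"
    unfolding A_def using fst_concat_groups by blast
  ultimately have tw: "takeWhile (\<lambda>a. fst a = Short) (A @ arc_group s0 k Long s j @ B) = A"
    by (simp add: takeWhile_append)
  have len: "length (A @ arc_group s0 k Long s j @ B) = s * 2 ^ k + j"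
    using num_buckets_canon[of j k s0 s] assms(2) by (simp add: num_buckets_def as)
  \<comment> \<open>The fresh number is that of arc \<open>s\<close> in group \<open>j\<close>, by
    \<open>bucket_ge\<close> and \<open>s0 \<le> s\<close>.\<close>
  have "arc_group s0 k Short s j @ [(Short, s * 2 ^ k + j)] = arc_group s0 k Short (s + 1) j"
    using assms by (simp add: arc_group_def bucket_ge)
  then have "new_bucket s0 st =
      (map snd (arc_group s0 k Long s j), \<lparr>par = s, arcs = A @ arc_group s0 k Short (s + 1) j @ B\<rparr>)"
    unfolding new_bucket_def Let_def assms(1) as tw len pre
    by (simp add: set_kind_group)
  moreover have "\<lparr>par = s, arcs = A @ arc_group s0 k Short (s + 1) j @ B\<rparr> = canon s0 k s (Suc j)"
    by (simp add: canon_def A_def B_def)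
  moreover have "map snd (arc_group s0 k Long s j) = map (bucket s0 k j) [0..<s]"
    by (simp add: arc_group_def)
  ultimately show ?thesis by simp
qed

lemma long_to_short_canon_pos:
  assumes "0 < j"
  shows "long_to_short s0 (canon s0 k s j) = canon s0 k s j"
proof -
  have "(Short, bucket s0 k 0 0) \<in> set (arcs (canon s0 k s j))"
    using assms by (force simp: canon_def arc_group_def simp del: upt_Suc)
  then have "\<not> all_kind Long (canon s0 k s j)"
    by (force simp: all_kind_def)
  then show ?thesis by (simp add: long_to_short_def)
qed

lemma long_to_short_canon_zero:
  assumes "0 < s0"
  shows "s0 < s \<Longrightarrow> long_to_short s0 (canon s0 k s 0) = canon s0 k (s - 1) (2 ^ k)"
    and "long_to_short s0 (canon s0 (Suc k) s0 0) = canon s0 k (2 * s0 - 1) (2 ^ k)"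
proof -
  have all: "all_kind Long (canon s0 k s 0)" for k s
    by (auto simp: all_kind_def canon_def arc_group_def)
  show "long_to_short s0 (canon s0 k s 0) = canon s0 k (s - 1) (2 ^ k)" if "s0 < s"
    using all[of k s] that by (auto simp: long_to_short_def canon_def set_kind_concat_groups)
  have "Suc (2 * s0 - 1) = 2 * s0"
    using assms by simp
  then show "long_to_short s0 (canon s0 (Suc k) s0 0) = canon s0 k (2 * s0 - 1) (2 ^ k)"
    using all[of "Suc k" s0] concat_groups_split[of s0 k Short]
    by (auto simp: long_to_short_def canon_def set_kind_concat_groups)
qed

text \<open>The state with \<open>Suc j\<close> short groups is what \<open>new_bucket\<close> makes
  of the one with \<open>j\<close>, so \<open>free_bucket_new_bucket\<close> applies.\<close>

lemma free_bucket_canon: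
  assumes "long_to_short s0 st = canon s0 k s (Suc j)" "j < 2 ^ k" "s0 \<le> s" "0 < s0"
  shows "free_bucket s0 st = (map (bucket s0 k j) [0..<s] @ [s * 2 ^ k + j], canon s0 k s j)"
proof -
  have stl: "short_to_long s0 (canon s0 k s j) = canon s0 k s j"
    using assms by (intro short_to_long_canon_less) auto
  have new: "new_bucket s0 (canon s0 k s j) = (map (bucket s0 k j) [0..<s], canon s0 k s (Suc j))"
    using assms stl by (intro new_bucket_canon) auto
  \<comment> \<open>\<open>free_bucket\<close> sees its argument only through
    \<open>long_to_short\<close>, which fixes the canonical state since \<open>Suc j\<close> is
    positive.\<close>
  have "free_bucket s0 st = free_bucket s0 (canon s0 k s (Suc j))"
    unfolding free_bucket_def assms(1) by (simp add: long_to_short_canon_pos)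
  also have "\<dots> = free_bucket s0 (snd (new_bucket s0 (canon s0 k s j)))"
    by (simp add: new)
  also have "\<dots> = (fst (new_bucket s0 (canon s0 k s j)) @ [num_buckets (canon s0 k s j)],
      short_to_long s0 (canon s0 k s j))"
  proof (rule free_bucket_new_bucket)
    show "arcs (short_to_long s0 (canon s0 k s j)) =
        concat (map (arc_group s0 k Short (s + 1)) [0..<j]) @ concat (map (arc_group s0 k Long s) [j..<2 ^ k])"
      unfolding stl by (simp add: canon_def)
    show "par (short_to_long s0 (canon s0 k s j)) \<le> length (concat (map (arc_group s0 k Long s) [j..<2 ^ k]))"
      using assms(2) unfolding stl by (simp add: canon_def Suc_leI)
    show "\<forall>a\<in>set (concat (map (arc_group s0 k Short (s + 1)) [0..<j])). fst a = Short"
      "\<forall>a\<in>set (concat (map (arc_group s0 k Long s) [j..<2 ^ k])). fst a = Long"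
      using fst_concat_groups by blast+
  qed (use assms stl in \<open>simp add: canon_def\<close>)
  finally show ?thesis
    using assms(2) by (simp add: new stl num_buckets_canon)
qed

section \<open>Locating a point of the circle\<close>

lemma find_bucketI:
  assumes "i < length (arcs st)" "arc_start st i \<le> u" "u < arc_start st (Suc i)"
    and "\<And>i. 0 \<le> arc_length st i"
  shows "find_bucket st u = snd (arcs st ! i)"
proof -
  \<comment> \<open>Nonnegative lengths make \<open>arc_start\<close> monotone, so the half-open
    intervals of distinct arcs are disjoint; this gives the uniqueness behind
    \<open>THE\<close>.\<close>
  have mono: "i \<le> i' \<Longrightarrow> arc_start st i \<le> arc_start st i'" for i i'
    unfolding arc_start_def using assms(4) by (intro sum_mono2) auto
  have "(THE i. i < length (arcs st) \<and> arc_start st i \<le> u \<and> u < arc_start st (Suc i)) = i"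
  proof (rule the_equality)
    fix i' assume i': "i' < length (arcs st) \<and> arc_start st i' \<le> u \<and> u < arc_start st (Suc i')"
    show "i' = i"
    proof (rule ccontr)
      assume "i' \<noteq> i"
      then consider "Suc i' \<le> i" | "Suc i \<le> i'" by linarith
      then show False
        using mono i' assms(2,3) by cases (meson leD le_less_trans order_trans)+
    qed
  qed (use assms in auto)
  then show ?thesis by (simp add: find_bucket_def)
qed

lemma arc_start_eq:
  assumes "i \<le> length (arcs st)"
  shows "arc_start st i = lam st * (\<Sum>a\<leftarrow>take i (arcs st). 1 / real (divisor st (fst a)))"
proof -
  have "(\<Sum>a\<leftarrow>take i (arcs st). 1 / real (divisor st (fst a))) =
      (\<Sum>j<i. 1 / real (divisor st (fst (arcs st ! j))))"
    using assms by (simp add: sum_list_sum_nth atLeast0LessThan)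
  then show ?thesis
    by (simp add: arc_start_def arc_length_def sum_distrib_left)
qed

text \<open>Each group has as many arcs as the divisor of its kind, so all groups have length
  \<open>1 / 2 ^ k\<close>. Scaling the point by \<open>2 ^ k\<close> gives \<open>g\<close> as
  integer part, and scaling the fractional part by the \<open>d\<close> arcs of that group gives
  \<open>r\<close>.\<close>

lemma find_bucket_canon:
  assumes s: "s0 \<le> s" "0 < s0" and j: "j \<le> 2 ^ k" and ab: "a < b"
  defines "g \<equiv> a * 2 ^ k div b"
  defines "d \<equiv> (if g < j then s + 1 else s)"
  defines "r \<equiv> (a * 2 ^ k mod b) * d div b"
  shows "g < 2 ^ k" "r < d"
    "find_bucket (canon s0 k s j) (real a / real b) = bucket s0 k g r"
proof -
  define st where "st = canon s0 k s j"
  define grp where "grp i = (if i < j then arc_group s0 k Short (s + 1) i else arc_group s0 k Long s i)" for i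
  define inv where "inv a = 1 / real (divisor st (fst a))" for a :: "kind \<times> nat"
  define rem where "rem = a * 2 ^ k mod b"
  show g: "g < 2 ^ k"
    unfolding g_def using ab by (simp add: less_mult_imp_div_less mult.commute)
  have d: "0 < d" using s by (simp add: d_def)
  have rem: "rem < b" using ab by (simp add: rem_def)
  show r: "r < d"
    unfolding r_def rem_def[symmetric] using rem d by (simp add: less_mult_imp_div_less mult.commute)
  have "[0..<2 ^ k] = [0..<j] @ [j..<2 ^ k]"
    using j upt_add_eq_append[of 0 j "2 ^ k - j"] by simp
  moreover have "map grp [0..<j] = map (arc_group s0 k Short (s + 1)) [0..<j]"
    "map grp [j..<2 ^ k] = map (arc_group s0 k Long s) [j..<2 ^ k]"
    by (auto simp: grp_def)
  ultimately have as: "arcs st = concat (map grp [0..<2 ^ k])"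
    by (simp only: st_def canon_def map_append concat_append rm_state.simps)
  have inv: "inv (Long, x) = 1 / real s" "inv (Short, x) = 1 / real (s + 1)" for x
    by (simp_all add: inv_def divisor_def st_def canon_def)
  have sum1: "(\<Sum>a\<leftarrow>grp i. inv a) = 1" for i
    using s by (simp add: grp_def arc_group_def inv sum_list_triv o_def flip: add_divide_distrib)
  have sums: "(\<Sum>a\<leftarrow>concat (map grp xs). inv a) = real (length xs)" for xs
    by (induction xs) (simp_all add: sum1)
  have lam: "lam st = 1 / 2 ^ k"
    unfolding lam_def inv_def[symmetric] as sums by simp
  have grp_g: "length (grp g) = d"
    by (simp add: grp_def d_def)
  have take_sum: "(\<Sum>a\<leftarrow>take r' (grp g). inv a) = real r' / real d" if "r' \<le> d" for r'
    using that by (simp add: grp_def d_def arc_group_def inv sum_list_triv o_def take_map min_def del: upt_Suc split: if_splits)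
  define A where "A = concat (map grp [0..<g])"
  define B where "B = concat (map grp [Suc g..<2 ^ k])"
  have "[0..<2 ^ k] = [0..<g] @ g # [Suc g..<2 ^ k]"
    using g upt_add_eq_append[of 0 g "2 ^ k - g"] by (simp add: upt_conv_Cons)
  then have as': "arcs st = A @ grp g @ B"
    unfolding as A_def B_def by simp
  define i where "i = length A + r"
  have start: "arc_start st (length A + r') = (real g + real r' / real d) / 2 ^ k" if "r' \<le> d" for r'
  proof -
    have "take (length A + r') (arcs st) = A @ take r' (grp g)"
      using that grp_g by (simp add: as')
    moreover have "(\<Sum>a\<leftarrow>A. inv a) = real g"
      by (simp add: A_def sums)
    ultimately show ?thesis
      using that grp_g take_sum[OF that] unfolding inv_def
      by (subst arc_start_eq) (simp_all add: as' lam)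
  qed
  have u: "real a / real b = (real g + real rem / real b) / 2 ^ k"
  proof -
    have "a * 2 ^ k = g * b + rem"
      by (simp add: g_def rem_def)
    then have "real a * 2 ^ k = real g * real b + real rem"
      by (metis of_nat_add of_nat_mult of_nat_numeral of_nat_power)
    then show ?thesis
      using ab by (simp add: field_simps)
  qed
  have "find_bucket st (real a / real b) = snd (arcs st ! i)"
  proof (rule find_bucketI)
    show "i < length (arcs st)"
      using r grp_g by (simp add: i_def as')
    \<comment> \<open>The floor inequalities \<open>r * b \<le> rem * d < (r + 1) * b\<close> are
      the two endpoint conditions within the group, multiplied by \<open>b * d\<close>.\<close>
    have "r * b \<le> rem * d"
      by (simp add: r_def rem_def)
    then have "real r * real b \<le> real rem * real d"
      by (metis of_nat_le_iff of_nat_mult)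
    then have "real r / real d \<le> real rem / real b"
      using d ab by (simp add: field_simps)
    then show "arc_start st i \<le> real a / real b"
      unfolding i_def u using r by (simp add: start divide_right_mono)
    have "rem * d < (r + 1) * b"
      unfolding r_def rem_def[symmetric] using ab
      by (metis add.commute dividend_less_div_times less_nat_zero_code mult.commute
          mult_Suc_right neq0_conv plus_1_eq_Suc)
    then have "real rem * real d < real (r + 1) * real b"
      by (metis of_nat_less_iff of_nat_mult)
    then have "real rem / real b < real (Suc r) / real d"
      using d ab by (simp add: field_simps)
    then show "real a / real b < arc_start st (Suc i)"
      using start[of "Suc r"] r unfolding i_def u by (simp add: divide_strict_right_mono)
    show "0 \<le> arc_length st i'" for i'
      by (simp add: arc_length_def lam)
  qed
  also have "\<dots> = bucket s0 k g r"
    using r by (cases "g < j")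
      (simp_all add: as' i_def nth_append grp_def d_def arc_group_def del: upt_Suc)
  finally show "find_bucket (canon s0 k s j) (real a / real b) = bucket s0 k g r"
    by (simp add: st_def)
qed

section \<open>Symbolic execution\<close>

text \<open>An upper bound on time lets branches of different lengths share one statement. The
  postcondition sees memory and output only, since the next program restarts at address 0 with its
  own input.\<close>

definition halts ::
  "nat \<Rightarrow> instr list \<Rightarrow> (nat list \<Rightarrow> nat list \<Rightarrow> bool) \<Rightarrow> nat \<Rightarrow> config \<Rightarrow> bool" where
  "halts w P Q T c \<longleftrightarrow> (\<exists>t c'. t \<le> T \<and> exec w P c t c' \<and> Q (mem c') (out c'))"

lemma halts_halt:
  assumes "pc c < length P" "P ! pc c = Halt" "0 < T" "Q (mem c) (out c)"
  shows "halts w P Q T c"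
  unfolding halts_def
  by (rule exI[of _ 1], rule exI[of _ c]) (use assms exec_halt in auto)

text \<open>Used as a rule, it executes one instruction forwards and pays for it with one unit of
  the budget \<open>T\<close>.\<close>

lemma halts_step:
  assumes "pc c < length P" "P ! pc c = ins" "step w ins c = Some c'" "0 < T"
    and "halts w P Q (T - 1) c'"
  shows "halts w P Q T c"
proof -
  obtain t c'' where "t \<le> T - 1" "exec w P c' t c''" "Q (mem c'') (out c'')"
    using assms(5) by (auto simp: halts_def)
  then show ?thesis
    using assms exec_step[of c P w c' t c'']
    unfolding halts_def by (intro exI[of _ "Suc t"] exI[of _ c'']) auto
qed

lemma halts_mono: "halts w P Q T c \<Longrightarrow> T \<le> T' \<Longrightarrow> halts w P Q T' c"
  unfolding halts_def by (meson order_trans)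

lemma halts_computes:
  assumes "halts w P Q T \<lparr>pc = 0, mem = m, inp = xs, out = []\<rparr>"
  shows "\<exists>t m' ys. t \<le> T \<and> computes w P m xs t m' ys \<and> Q m' ys"
  using assms unfolding halts_def computes_def by blast

declare alu_sem.simps [simp del]

text \<open>With \<open>alu_sem.simps\<close> out of the simpset, additions and subtractions are
  evaluated only after proving that they do not wrap around.\<close>

lemma alu_add: "x + y < 2 ^ w \<Longrightarrow> alu_sem w Add x y = x + y"
  by (simp add: alu_sem.simps)

lemma alu_sub: "y \<le> x \<Longrightarrow> x < 2 ^ w \<Longrightarrow> alu_sem w Sub x y = x - y"
proof -
  assume "y \<le> x" "x < 2 ^ w"
  then have "x + 2 ^ w - y = (x - y) + 2 ^ w" "x - y < 2 ^ w"
    by simp_all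
  then show ?thesis
    by (simp only: alu_sem.simps mod_add_self2 mod_less)
qed

lemmas exec_simps = get_def put_def next_mem_def nth_list_update alu_add alu_sub

section \<open>The programs\<close>

text \<open>
  Registers 0 to 6 hold \<open>s0\<close>, \<open>s\<close>, \<open>2 ^ k\<close>, \<open>j\<close>, the number of buckets, and the constants 1 and 0.
  The code below puts \<open>bucket s0 k g r\<close> into register 9, for \<open>g\<close> in register 7 and \<open>r\<close> in register 8.
\<close>

definition bucket_code :: "nat \<Rightarrow> instr list" where
  "bucket_code b =
     [Jump_less 8 0 (b + 4),
      Mul 10 9 8 2, Alu Add 9 9 7, Jump (b + 15),
      Jump_zero 7 (b + 14),
      Alu Sub 10 7 5, Alu Xor 10 10 7, Alu Add 10 10 5,
      Div 11 12 6 2 10, Alu Add 12 8 0, Mul 13 9 12 11,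
      Div 11 12 6 7 10, Alu Add 9 9 11, Jump (b + 15),
      Alu Add 9 8 6]"

text \<open>The test follows the body, so the loop must be entered with
  \<open>r < s\<close>.\<close>

definition loop_code :: "nat \<Rightarrow> instr list" where
  "loop_code b = bucket_code b @ [Write 9, Alu Add 8 8 5, Jump_less 8 1 b]"

lemma nth_of_take_drop:
  assumes "take n (drop b P) = C" "i < n" "b + n \<le> length P"
  shows "P ! (b + i) = C ! i"
  using assms by auto

lemma length_bucket_code [simp]: "length (bucket_code b) = 15"
  by (simp add: bucket_code_def)

text \<open>Stated with a continuation \<open>cont\<close>, so that the code can be reused at any
  offset \<open>b\<close> of any program. Registers from 10 on are scratch; 15 bounds the longest of
  the three branches.\<close>

lemma halts_bucket_code:
  assumes code: "take 15 (drop b P) = bucket_code b" "b + 15 \<le> length P"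
    and mem: "length m = 19" "m ! 0 = s0" "m ! 2 = 2 ^ k" "m ! 5 = 1" "m ! 6 = 0"
      "m ! 7 = g" "m ! 8 = r"
    and bounds: "g < 2 ^ k" "2 ^ k < (2 ^ w :: nat)" "r < 2 ^ w" "bucket s0 k g r < 2 ^ w"
    and cont: "\<And>m'. length m' = 19 \<Longrightarrow> (\<And>i. i < 9 \<Longrightarrow> m' ! i = m ! i) \<Longrightarrow> m' ! 9 = bucket s0 k g r \<Longrightarrow>
      halts w P Q T \<lparr>pc = b + 15, mem = m', inp = xs, out = ys\<rparr>"
  shows "halts w P Q (T + 15) \<lparr>pc = b, mem = m, inp = xs, out = ys\<rparr>"
proof -
  have P: "P ! (b + i) = bucket_code b ! i" if "i < 15" for i
    using nth_of_take_drop[OF code(1) that code(2)] .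
  have "P ! b = bucket_code b ! 0" "P ! Suc b = bucket_code b ! 1" "P ! Suc (Suc b) = bucket_code b ! 2"
    using P[of 0] P[of 1] P[of 2] by simp_all
  note c = P this P[unfolded add.commute[of b]] bucket_code_def
  have len: "b + i < length P" "i + b < length P" if "i < 15" for i
    using code(2) that by simp_all
  have len': "b < length P" "Suc b < length P" "Suc (Suc b) < length P"
    using code(2) by simp_all
  have suc: "Suc (Suc (Suc b)) = b + 3"
    by simp
  have gw: "g < 2 ^ w"
    using bounds(1,2) by (rule less_trans)
  \<comment> \<open>One case per branch of the code. Group 0 is apart because \<open>ruler\<close>
    has its power-of-2 meaning only for positive \<open>g\<close>.\<close>
  consider "s0 \<le> r" | "r < s0" "g = 0" | "r < s0" "0 < g" by linarith
  then show ?thesis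
  proof cases
    case 1
    then have b: "bucket s0 k g r = r * 2 ^ k + g"
      using bounds by (simp add: bucket_ge)
    then have *: "r * 2 ^ k < 2 ^ w" "r * 2 ^ k + g < 2 ^ w" "\<not> r < s0"
      using bounds 1 by simp_all
    show ?thesis
      apply (rule halts_step, simp add: len len', simp add: c, simp add: mem * exec_simps, simp, simp add: suc)+
      by (rule halts_mono[OF cont]) (simp_all add: mem nth_list_update b)
  next
    case 2
    then have b: "bucket s0 k g r = r"
      by (simp add: bucket_zero)
    show ?thesis
      apply (rule halts_step, simp add: len len', simp add: c, simp add: mem 2 bounds exec_simps, simp, simp add: suc)+
      by (rule halts_mono[OF cont[unfolded add.commute[of b]]]) (use b 2 in \<open>simp_all add: mem nth_list_update\<close>)
  next
    case 3
    define e where "e = ruler g"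
    have e: "Bit_Operations.xor (g - Suc 0) g = e - Suc 0" "0 < e" "e \<le> 2 ^ k"
      using ruler_le[of g k] 3 bounds by (simp_all add: e_def ruler_def)
    define q where "q = 2 ^ k div e"
    have b: "bucket s0 k g r = (s0 + r) * q + g div e"
      using bucket_ruler[of g k r s0] 3 bounds by (simp add: e_def q_def)
    \<comment> \<open>As \<open>q\<close> is positive, the intermediate values \<open>r + s0\<close>
      and \<open>(r + s0) * q\<close> are bounded by the bucket number, hence are words.\<close>
    have "0 < q"
      using e by (simp add: q_def div_greater_zero_iff)
    then have le: "r + s0 \<le> (r + s0) * q"
      by simp
    have sum: "(r + s0) * q + g div e < 2 ^ w"
      using b bounds(4) by (simp add: add.commute)
    note * = sum add_lessD1[OF sum] le_less_trans[OF le add_lessD1[OF sum]]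
    have **: "e < 2 ^ w" "Suc 0 \<le> g" "g \<noteq> 0"
      using le_less_trans[OF e(3) bounds(2)] e(2) 3 by simp_all
    have xor: "alu_sem w Xor x y = Bit_Operations.xor x y" for x y
      by (simp add: alu_sem.simps)
    show ?thesis
      apply (rule halts_step, simp add: len len', simp add: c, simp add: mem 3 gw * ** e q_def[symmetric] xor exec_simps, simp, simp add: suc)+
      by (rule halts_mono[OF cont]) (simp_all add: mem nth_list_update b add.commute)
  qed
qed

text \<open>At most 15 instructions compute a number and three write it, count and test: 18 per arc.
  Register 8 is the counter, so only the registers below it are preserved.\<close>

lemma halts_loop_code:
  assumes code: "take 18 (drop b P) = loop_code b" "b + 18 \<le> length P"
    and mem: "length m = 19" "m ! 0 = s0" "m ! 1 = s" "m ! 2 = 2 ^ k" "m ! 5 = 1" "m ! 6 = 0"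
      "m ! 7 = g" "m ! 8 = r"
    and s: "r < s" "s0 \<le> s" "g < 2 ^ k" "s * 2 ^ k < 2 ^ w"
    and cont: "\<And>m'. length m' = 19 \<Longrightarrow> (\<And>i. i < 8 \<Longrightarrow> m' ! i = m ! i) \<Longrightarrow>
      halts w P Q T \<lparr>pc = b + 18, mem = m', inp = xs, out = ys @ map (bucket s0 k g) [r..<s]\<rparr>"
  shows "halts w P Q (T + 18 * (s - r)) \<lparr>pc = b, mem = m, inp = xs, out = ys\<rparr>"
proof -
  have P: "P ! (b + i) = loop_code b ! i" if "i < 18" for i
    using nth_of_take_drop[OF code(1) that code(2)] .
  have P': "P ! (b + 15) = Write 9" "P ! (b + 16) = Alu Add 8 8 5" "P ! (b + 17) = Jump_less 8 1 b"
    using P[of 15] P[of 16] P[of 17] by (simp_all add: loop_code_def nth_append)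
  have len: "b + 15 < length P" "b + 16 < length P" "b + 17 < length P"
    using code(2) by simp_all
  note P'' = P' len this[unfolded add.commute[of b]] P'[unfolded add.commute[of b]]
  have "take 15 (take 18 (drop b P)) = bucket_code b"
    unfolding code by (simp add: loop_code_def)
  then have code': "take 15 (drop b P) = bucket_code b"
    by (simp add: take_take)
  have "s * 1 \<le> s * 2 ^ k" "1 * 2 ^ k \<le> s * 2 ^ k"
    using s(1) by (intro mult_left_mono mult_right_mono; simp)+
  then have w: "s < 2 ^ w" "2 ^ k < (2 ^ w :: nat)"
    using s(4) by linarith+
  \<comment> \<open>Induction on the iterations left after the current one; for \<open>0\<close> the
    test falls through.\<close>
  obtain n where "s = r + Suc n"
    using s(1) less_iff_Suc_add by auto
  then show ?thesis
    using mem s(1) cont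
  proof (induction n arbitrary: r m ys)
    case (Suc n)
    note mem = Suc.prems(2-9) and s' = Suc.prems(1,10) and cont = Suc.prems(11)
    have "halts w P Q ((T + 18 * (s - Suc r) + 3) + 15) \<lparr>pc = b, mem = m, inp = xs, out = ys\<rparr>"
    proof (rule halts_bucket_code[OF code' _ mem(1,2,4-8) s(3) w(2)])
      fix m' assume m': "length m' = 19" "\<And>i. i < 9 \<Longrightarrow> m' ! i = m ! i" "m' ! 9 = bucket s0 k g r"
      have *: "m' ! 0 = s0" "m' ! Suc 0 = s" "m' ! 2 = 2 ^ k" "m' ! 5 = 1" "m' ! 6 = 0" "m' ! 7 = g" "m' ! 8 = r"
        using m'(2) mem by simp_all
      have step: "halts w P Q (T + 18 * (s - Suc r))
          \<lparr>pc = b, mem = m'[8 := Suc r], inp = xs, out = ys @ [bucket s0 k g r]\<rparr>"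
      proof (rule Suc.IH)
        fix m'' assume m'': "length m'' = 19" "\<And>i. i < 8 \<Longrightarrow> m'' ! i = m'[8 := Suc r] ! i"
        have "[r..<s] = r # [Suc r..<s]"
          using s' by (simp add: upt_conv_Cons)
        then show "halts w P Q T \<lparr>pc = b + 18, mem = m'', inp = xs,
            out = (ys @ [bucket s0 k g r]) @ map (bucket s0 k g) [Suc r..<s]\<rparr>"
          using cont[of m''] m'' m' by simp
      qed (use s' * m'(1) in simp_all)
      have **: "Suc r < s" "Suc r < 2 ^ w"
        using s' w by simp_all
      show "halts w P Q (T + 18 * (s - Suc r) + 3) \<lparr>pc = b + 15, mem = m', inp = xs, out = ys\<rparr>"
        apply (rule halts_step, simp add: P'', simp add: P'', simp add: m'(1,3) * ** exec_simps, simp, simp)+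
        using step by (simp add: nth_list_update)
    next
      show "bucket s0 k g r < 2 ^ w"
        using bucket_less[OF s(3) s'(2) s(2)] s(4) by simp
    qed (use code s' w in simp_all)
    then show ?case
      using s' by (simp add: algebra_simps)
  next
    case 0
    note mem = "0.prems"(2-9) and s' = "0.prems"(1,10) and cont = "0.prems"(11)
    have "halts w P Q ((T + 3) + 15) \<lparr>pc = b, mem = m, inp = xs, out = ys\<rparr>"
    proof (rule halts_bucket_code[OF code' _ mem(1,2,4-8) s(3) w(2)])
      fix m' assume m': "length m' = 19" "\<And>i. i < 9 \<Longrightarrow> m' ! i = m ! i" "m' ! 9 = bucket s0 k g r"
      have *: "m' ! 0 = s0" "m' ! Suc 0 = s" "m' ! 2 = 2 ^ k" "m' ! 5 = 1" "m' ! 6 = 0" "m' ! 7 = g" "m' ! 8 = r"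
        using m'(2) mem by simp_all
      have **: "Suc r = s" "s < 2 ^ w"
        using s' w by simp_all
      have step: "halts w P Q T \<lparr>pc = b + 18, mem = m'[8 := s], inp = xs, out = ys @ [bucket s0 k g r]\<rparr>"
        using cont[of "m'[8 := s]"] m' s' by simp
      show "halts w P Q (T + 3) \<lparr>pc = b + 15, mem = m', inp = xs, out = ys\<rparr>"
        apply (rule halts_step, simp add: P'', simp add: P'', simp add: m'(1,3) * ** exec_simps, simp, simp)+
        using step by (simp add: add.commute)
    next
      show "bucket s0 k g r < 2 ^ w"
        using bucket_less[OF s(3) s'(2) s(2)] s(4) by simp
    qed (use code s' w in simp_all)
    then show ?case
      using s' by (simp add: algebra_simps)
  qed
qed

text \<open>Adding register 6, which holds 0, serves as the copy instruction here and in the other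
  programs.\<close>

definition init_code :: "instr list" where
  "init_code =
     [Read 0, Const 5 1, Const 6 0, Alu Add 1 0 6, Const 2 1, Const 3 0, Alu Add 4 0 6, Halt]"

definition num_code :: "instr list" where
  "num_code = [Write 4, Halt]"

text \<open>The first division leaves \<open>g\<close> in register 7 and the remainder in 18. The
  remainder is multiplied by the arc count of group \<open>g\<close> (register 12) and divided by
  the same denominator to give \<open>r\<close>.\<close>

definition find_code :: "instr list" where
  "find_code =
     [Read 14, Read 15, Mul 16 17 14 2, Div 7 18 16 17 15,
      Alu Add 12 1 6, Jump_less 7 3 7, Jump 8, Alu Add 12 12 5,
      Mul 16 17 18 12, Div 8 18 16 17 15] @
     bucket_code 10 @ [Write 9, Halt]"

text \<open>\<open>s + 1 < 2 * s0\<close> is tested as \<open>s + 1 - s0 < s0\<close>, because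
  \<open>2 * s0\<close> need not fit into a word.\<close>

definition new_code :: "instr list" where
  "new_code =
     [Jump_less 3 2 7,
      Const 3 0, Alu Add 1 1 5, Alu Sub 9 1 0, Jump_less 9 0 7,
      Alu Add 1 0 6, Alu Add 2 2 2,
      Alu Add 7 3 6, Const 8 0] @
     loop_code 9 @ [Alu Add 3 3 5, Alu Add 4 4 5, Halt]"

text \<open>If the groups have to be merged, \<open>s\<close> is first set to \<open>2 * s0\<close>,
  so that the decrement shared with the other redeclaring case yields
  \<open>2 * s0 - 1\<close>.\<close>

definition free_code :: "instr list" where
  "free_code =
     [Jump_zero 3 2, Jump 7,
      Jump_less 0 1 5, Alu Add 1 0 0, Alu Shr 2 2 5,
      Alu Sub 1 1 5, Alu Add 3 2 6,
      Alu Sub 3 3 5, Alu Sub 4 4 5, Alu Add 7 3 6, Const 8 0] @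
     loop_code 11 @ [Write 4, Halt]"

lemmas find_code_defs = find_code_def bucket_code_def
lemmas new_code_defs = new_code_def loop_code_def bucket_code_def
lemmas free_code_defs = free_code_def loop_code_def bucket_code_def

text \<open>The invariant between operations. Registers 7 to 18 are scratch and unconstrained; the
  bound on the number of buckets supplies the word bounds on \<open>s\<close>, \<open>2 ^ k\<close>
  and \<open>j\<close>.\<close>

definition represents :: "nat \<Rightarrow> nat \<Rightarrow> nat \<Rightarrow> nat \<Rightarrow> nat \<Rightarrow> nat list \<Rightarrow> bool" where
  "represents w s0 k s j m \<longleftrightarrow>
     1 < s0 \<and> s0 \<le> s \<and> s < 2 * s0 \<and> j \<le> 2 ^ k \<and> s * 2 ^ k + j < 2 ^ w \<and> length m = 19 \<and>
     m ! 0 = s0 \<and> m ! 1 = s \<and> m ! 2 = 2 ^ k \<and> m ! 3 = j \<and> m ! 4 = s * 2 ^ k + j \<and>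
     m ! 5 = 1 \<and> m ! 6 = 0"

lemma representsD:
  assumes "represents w s0 k s j m"
  shows "1 < s0" "s0 \<le> s" "s < 2 * s0" "j \<le> 2 ^ k" "s * 2 ^ k + j < 2 ^ w" "length m = 19"
    "m ! 0 = s0" "m ! Suc 0 = s" "m ! 2 = 2 ^ k" "m ! 3 = j" "m ! 4 = s * 2 ^ k + j"
    "m ! 5 = Suc 0" "m ! 6 = 0"
    "s < 2 ^ w" "s0 < 2 ^ w" "2 ^ k < (2 ^ w :: nat)" "k < w" "j < 2 ^ w" "s * 2 ^ k < 2 ^ w" "1 < (2 ^ w :: nat)"
proof -
  show *: "1 < s0" "s0 \<le> s" "s < 2 * s0" "j \<le> 2 ^ k" "s * 2 ^ k + j < 2 ^ w" "length m = 19"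
    "m ! 0 = s0" "m ! Suc 0 = s" "m ! 2 = 2 ^ k" "m ! 3 = j" "m ! 4 = s * 2 ^ k + j"
    "m ! 5 = Suc 0" "m ! 6 = 0"
    using assms by (simp_all add: represents_def)
  have "s * 1 \<le> s * 2 ^ k" "1 * 2 ^ k \<le> s * 2 ^ k"
    using * by (intro mult_left_mono mult_right_mono; simp)+
  then show "s < 2 ^ w" "s0 < 2 ^ w" and k: "2 ^ k < (2 ^ w :: nat)" and
    "j < 2 ^ w" "s * 2 ^ k < 2 ^ w" "1 < (2 ^ w :: nat)"
    using * by linarith+
  show "k < w"
    using k by simp
qed

section \<open>Initialisation and queries\<close>

lemma halts_init_code:
  assumes "1 < s0" "s0 < 2 ^ w" "length m = 19"
  shows "halts w init_code (\<lambda>m' ys. represents w s0 0 s0 0 m' \<and> ys = []) 8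
    \<lparr>pc = 0, mem = m, inp = [s0], out = []\<rparr>"
proof -
  \<comment> \<open>The word size is positive, so the constant 1 survives reduction modulo
    \<open>2 ^ w\<close>.\<close>
  have w: "1 < (2 ^ w :: nat)" "0 < w"
    using assms by (simp, cases w, auto)
  show ?thesis
    apply (rule halts_step, simp add: init_code_def, simp add: init_code_def, simp add: assms w exec_simps, simp, simp)+
    by (rule halts_halt) (use assms in \<open>simp_all add: init_code_def represents_def nth_list_update\<close>)
qed

lemma halts_num_code:
  assumes "represents w s0 k s j m"
  shows "halts w num_code (\<lambda>m' ys. represents w s0 k s j m' \<and> ys = [s * 2 ^ k + j]) 2
    \<lparr>pc = 0, mem = m, inp = [], out = []\<rparr>"
  apply (rule halts_step, simp add: num_code_def, simp add: num_code_def, simp add: representsD[OF assms] exec_simps, simp, simp)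
  by (rule halts_halt) (use assms in \<open>simp_all add: num_code_def\<close>)

text \<open>This is the condition under which \<open>Div\<close> does not fault: the high word of
  the product is below the divisor.\<close>

lemma mult_div_word_less:
  fixes x y b :: nat
  assumes "x < b" "y < 2 ^ w"
  shows "x * y div 2 ^ w < b"
proof -
  have "x * y \<le> x * 2 ^ w"
    using assms by simp
  then have "x * y div 2 ^ w \<le> x"
    by (metis div_le_mono nonzero_mult_div_cancel_right power_not_zero zero_neq_numeral)
  then show ?thesis
    using assms by simp
qed

lemma double_word: "(x::nat) div 2 ^ w * 2 ^ w + x mod 2 ^ w = x"
  by (rule div_mult_mod_eq)

lemma halts_find_code:
  assumes rep: "represents w s0 k s j m" and ab: "a < b" "b < 2 ^ w"
  shows "halts w find_code
    (\<lambda>m' ys. represents w s0 k s j m' \<and> ys = [find_bucket (canon s0 k s j) (real a / real b)]) 27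
    \<lparr>pc = 0, mem = m, inp = [a, b], out = []\<rparr>"
proof -
  note D = representsD[OF rep]
  define g where "g = a * 2 ^ k div b"
  define d where "d = (if g < j then s + 1 else s)"
  define x where "x = a * 2 ^ k mod b"
  define r where "r = x * d div b"
  have g: "g < 2 ^ k" and r: "r < d"
    and find: "find_bucket (canon s0 k s j) (real a / real b) = bucket s0 k g r"
    using find_bucket_canon[of s0 s j k a b] D ab unfolding g_def d_def x_def r_def by simp_all
  have "s \<le> s * 2 ^ k"
    by simp
  then have "g < j \<Longrightarrow> s + 1 < 2 ^ w"
    using D(5) by linarith
  then have dw: "d < 2 ^ w"
    using D(14) by (simp add: d_def)
  have xb: "x < b"
    using ab by (simp add: x_def)
  have bw: "bucket s0 k g r < 2 ^ w"
  proof (cases "r < s")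
    case True
    then show ?thesis
      using bucket_less[OF g True D(2)] D(19) by simp
  next
    case False
    \<comment> \<open>Only the last arc of a short group has index \<open>s\<close>; its number
      \<open>s * 2 ^ k + g\<close> is below the number of buckets because
      \<open>g < j\<close>.\<close>
    then have "g < j" "r = s"
      using r by (auto simp: d_def split: if_splits)
    then show ?thesis
      using bucket_ge[OF D(2) g] D(5) by simp
  qed
  have div: "a * 2 ^ k div 2 ^ w < b" "x * d div 2 ^ w < b"
    using mult_div_word_less ab(1) xb D(16) dw by blast+
  \<comment> \<open>Both outcomes of the test \<open>g < j\<close> meet at address 8.\<close>
  have tail: "halts w find_code
      (\<lambda>m' ys. represents w s0 k s j m' \<and> ys = [bucket s0 k g r]) 19
      \<lparr>pc = 8, mem = m', inp = [], out = []\<rparr>"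
    if m': "represents w s0 k s j m'" "m' ! 7 = g" "m' ! 12 = d" "m' ! 15 = b" "m' ! 18 = x" for m'
  proof -
    note D' = representsD[OF m'(1)]
    have "halts w find_code (\<lambda>m' ys. represents w s0 k s j m' \<and> ys = [bucket s0 k g r]) (2 + 15)
      \<lparr>pc = 10, mem = m'[16 := x * d div 2 ^ w, 17 := x * d mod 2 ^ w, 8 := r, 18 := x * d mod b],
       inp = [], out = []\<rparr>" (is "halts _ _ ?Q _ \<lparr>pc = _, mem = ?m, inp = _, out = _\<rparr>")
    proof (rule halts_bucket_code[OF _ _ _ _ _ _ _ _ _ g D(16) _ bw])
      fix m'' assume m'': "length m'' = 19" "\<And>i. i < 9 \<Longrightarrow> m'' ! i = ?m ! i" "m'' ! 9 = bucket s0 k g r"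
      then have rep'': "represents w s0 k s j m''"
        using m'(1) by (simp add: represents_def nth_list_update)
      show "halts w find_code ?Q 2 \<lparr>pc = 10 + 15, mem = m'', inp = [], out = []\<rparr>"
        apply (rule halts_step, simp add: find_code_defs, simp add: find_code_defs, simp add: m'' exec_simps, simp, simp)
        by (rule halts_halt) (use rep'' in \<open>simp_all add: find_code_def bucket_code_def\<close>)
    qed (use D' m' r dw in \<open>simp_all add: find_code_def bucket_code_def nth_list_update\<close>)
    then show ?thesis
      apply -
      apply (rule halts_step, simp add: find_code_defs, simp add: find_code_defs, simp add: D' m' div double_word r_def[symmetric] exec_simps, simp, simp)
      apply (rule halts_step, simp add: find_code_defs, simp add: find_code_defs, simp add: D' m' div double_word r_def[symmetric] exec_simps, simp, simp)
      done
  qed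
  have mem: "represents w s0 k s j
      (m[14 := a, 15 := b, 16 := a * 2 ^ k div 2 ^ w, 17 := a * 2 ^ k mod 2 ^ w, 7 := g, 18 := x, 12 := s])"
    "represents w s0 k s j
      (m[14 := a, 15 := b, 16 := a * 2 ^ k div 2 ^ w, 17 := a * 2 ^ k mod 2 ^ w, 7 := g, 18 := x, 12 := s, 12 := Suc s])"
    using rep by (simp_all add: represents_def nth_list_update)
  show ?thesis
    unfolding find
  proof (cases "g < j")
    case True
    then have "Suc s < 2 ^ w" "d = Suc s"
      using dw by (simp_all add: d_def)
    then show "halts w find_code
      (\<lambda>m' ys. represents w s0 k s j m' \<and> ys = [bucket s0 k g r]) 27
      \<lparr>pc = 0, mem = m, inp = [a, b], out = []\<rparr>"
      apply -
      apply (rule halts_step, simp add: find_code_defs, simp add: find_code_defs, simp add: D div True double_word g_def[symmetric] x_def[symmetric] exec_simps, simp, simp)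
      apply (rule halts_step, simp add: find_code_defs, simp add: find_code_defs, simp add: D div True double_word g_def[symmetric] x_def[symmetric] exec_simps, simp, simp)
      apply (rule halts_step, simp add: find_code_defs, simp add: find_code_defs, simp add: D div True double_word g_def[symmetric] x_def[symmetric] exec_simps, simp, simp)
      apply (rule halts_step, simp add: find_code_defs, simp add: find_code_defs, simp add: D div True double_word g_def[symmetric] x_def[symmetric] exec_simps, simp, simp)
      apply (rule halts_step, simp add: find_code_defs, simp add: find_code_defs, simp add: D div True double_word g_def[symmetric] x_def[symmetric] exec_simps, simp, simp)
      apply (rule halts_step, simp add: find_code_defs, simp add: find_code_defs, simp add: D div True double_word g_def[symmetric] x_def[symmetric] exec_simps, simp, simp)
      apply (rule halts_step, simp add: find_code_defs, simp add: find_code_defs, simp add: D div True double_word g_def[symmetric] x_def[symmetric] exec_simps, simp, simp)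
      apply (rule halts_mono[OF tail])
      using mem D by (simp_all add: nth_list_update)
  next
    case False
    then have "d = s"
      by (simp add: d_def)
    then show "halts w find_code
      (\<lambda>m' ys. represents w s0 k s j m' \<and> ys = [bucket s0 k g r]) 27
      \<lparr>pc = 0, mem = m, inp = [a, b], out = []\<rparr>"
      apply -
      apply (rule halts_step, simp add: find_code_defs, simp add: find_code_defs, simp add: D div False double_word g_def[symmetric] x_def[symmetric] exec_simps, simp, simp)
      apply (rule halts_step, simp add: find_code_defs, simp add: find_code_defs, simp add: D div False double_word g_def[symmetric] x_def[symmetric] exec_simps, simp, simp)
      apply (rule halts_step, simp add: find_code_defs, simp add: find_code_defs, simp add: D div False double_word g_def[symmetric] x_def[symmetric] exec_simps, simp, simp)
      apply (rule halts_step, simp add: find_code_defs, simp add: find_code_defs, simp add: D div False double_word g_def[symmetric] x_def[symmetric] exec_simps, simp, simp)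
      apply (rule halts_step, simp add: find_code_defs, simp add: find_code_defs, simp add: D div False double_word g_def[symmetric] x_def[symmetric] exec_simps, simp, simp)
      apply (rule halts_step, simp add: find_code_defs, simp add: find_code_defs, simp add: D div False double_word g_def[symmetric] x_def[symmetric] exec_simps, simp, simp)
      apply (rule halts_step, simp add: find_code_defs, simp add: find_code_defs, simp add: D div False double_word g_def[symmetric] x_def[symmetric] exec_simps, simp, simp)
      apply (rule halts_mono[OF tail])
      using mem D by (simp_all add: nth_list_update)
  qed
qed

section \<open>Adding a bucket\<close>

lemma halts_new_code_tail:
  assumes rep: "represents w s0 k s j m" and j: "j < 2 ^ k" "s * 2 ^ k + j + 1 < 2 ^ w"
  shows "halts w new_code
    (\<lambda>m' ys. represents w s0 k s (Suc j) m' \<and> ys = map (bucket s0 k j) [0..<s]) (18 * s + 5)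
    \<lparr>pc = 7, mem = m, inp = [], out = []\<rparr>"
proof -
  note D = representsD[OF rep]
  have jw: "Suc j < 2 ^ w" "Suc (s * 2 ^ k + j) < 2 ^ w"
    using j D(16) by linarith+
  have "halts w new_code
      (\<lambda>m' ys. represents w s0 k s (Suc j) m' \<and> ys = map (bucket s0 k j) [0..<s]) (3 + 18 * (s - 0))
      \<lparr>pc = 9, mem = m[7 := j, 8 := 0], inp = [], out = []\<rparr>"
    (is "halts _ _ ?Q _ \<lparr>pc = _, mem = ?m, inp = _, out = _\<rparr>")
  proof (rule halts_loop_code[OF _ _ _ _ _ _ _ _ _ _ _ D(2) j(1) D(19)])
    fix m' assume m': "length m' = 19" "\<And>i. i < 8 \<Longrightarrow> m' ! i = ?m ! i"
    have m'_old: "represents w s0 k s j m'"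
      using rep m' by (simp add: represents_def)
    note D' = representsD[OF this]
    show "halts w new_code ?Q 3
        \<lparr>pc = 9 + 18, mem = m', inp = [], out = [] @ map (bucket s0 k j) [0..<s]\<rparr>"
      apply (rule halts_step, simp add: new_code_defs, simp add: new_code_defs, simp add: D' jw exec_simps, simp, simp)
      apply (rule halts_step, simp add: new_code_defs, simp add: new_code_defs, simp add: D' jw exec_simps, simp, simp)
      by (rule halts_halt)
        (use D' j in \<open>simp_all add: new_code_def loop_code_def bucket_code_def represents_def nth_list_update\<close>)
  qed (use D in \<open>simp_all add: new_code_def loop_code_def bucket_code_def nth_list_update\<close>)
  then show ?thesis
    apply -
    apply (rule halts_step, simp add: new_code_defs, simp add: new_code_defs, simp add: D exec_simps, simp, simp)
    apply (rule halts_step, simp add: new_code_defs, simp add: new_code_defs, simp add: D exec_simps, simp, simp)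
    done
qed

lemma halts_new_code:
  assumes rep: "represents w s0 k s j m" and m: "s * 2 ^ k + j + 1 < 2 ^ w"
  shows "\<exists>k' s' j'. snd (new_bucket s0 (canon s0 k s j)) = canon s0 k' s' j' \<and>
    halts w new_code
      (\<lambda>m' ys. represents w s0 k' s' j' m' \<and> ys = fst (new_bucket s0 (canon s0 k s j))) (60 * s0)
      \<lparr>pc = 0, mem = m, inp = [], out = []\<rparr>"
proof -
  note D = representsD[OF rep]
  \<comment> \<open>No redeclaration, redeclaration with the same groups, or doubling of the groups;
    all three continue at address 7.\<close>
  consider "j < 2 ^ k" | "j = 2 ^ k" "s + 1 < 2 * s0" | "j = 2 ^ k" "s = 2 * s0 - 1"
    using D by linarith
  then show ?thesis
  proof cases
    case 1
    have new: "new_bucket s0 (canon s0 k s j) = (map (bucket s0 k j) [0..<s], canon s0 k s (Suc j))"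
      using D 1 by (intro new_bucket_canon short_to_long_canon_less) auto
    have "halts w new_code
      (\<lambda>m' ys. represents w s0 k s (Suc j) m' \<and> ys = map (bucket s0 k j) [0..<s]) (18 * s + 12)
      \<lparr>pc = 0, mem = m, inp = [], out = []\<rparr>"
      apply (rule halts_step, simp add: new_code_defs, simp add: new_code_defs, simp add: D 1 exec_simps, simp, simp)
      by (rule halts_mono[OF halts_new_code_tail[OF rep 1 m]]) (use D in simp)
    then show ?thesis
      unfolding new by (intro exI conjI, rule_tac [2] halts_mono) (use D in auto)
  next
    case 2
    have stl: "short_to_long s0 (canon s0 k s j) = canon s0 k (Suc s) 0"
      using D 2 by (simp add: short_to_long_canon_all)
    have new: "new_bucket s0 (canon s0 k s j) =
        (map (bucket s0 k 0) [0..<Suc s], canon s0 k (Suc s) (Suc 0))"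
      by (rule new_bucket_canon[OF stl]) (use D in auto)
    have "s * 1 \<le> s * 2 ^ k"
      by (intro mult_left_mono) auto
    then have w: "Suc s < 2 ^ w" "Suc s - s0 < s0" "s0 \<le> Suc s"
      using 2 D m by linarith+
    have mem: "represents w s0 k (Suc s) 0 (m[3 := 0, Suc 0 := Suc s, 9 := Suc s - s0])"
      using rep 2 by (simp add: represents_def nth_list_update algebra_simps)
    have "halts w new_code
      (\<lambda>m' ys. represents w s0 k (Suc s) (Suc 0) m' \<and> ys = map (bucket s0 k 0) [0..<Suc s]) (18 * Suc s + 12)
      \<lparr>pc = 0, mem = m, inp = [], out = []\<rparr>"
      apply (rule halts_step, simp add: new_code_defs, simp add: new_code_defs, simp add: D 2 w exec_simps, simp, simp del: upt_Suc)
      apply (rule halts_step, simp add: new_code_defs, simp add: new_code_defs, simp add: D 2 w exec_simps, simp, simp del: upt_Suc)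
      apply (rule halts_step, simp add: new_code_defs, simp add: new_code_defs, simp add: D 2 w exec_simps, simp, simp del: upt_Suc)
      apply (rule halts_step, simp add: new_code_defs, simp add: new_code_defs, simp add: D 2 w exec_simps, simp, simp del: upt_Suc)
      apply (rule halts_step, simp add: new_code_defs, simp add: new_code_defs, simp add: D 2 w exec_simps, simp, simp del: upt_Suc)
      by (rule halts_mono[OF halts_new_code_tail[OF mem]]) (use D 2 m in \<open>simp_all add: algebra_simps del: upt_Suc\<close>)
    then show ?thesis
      unfolding new by (intro exI conjI, rule_tac [2] halts_mono) (use D in auto)
  next
    case 3
    have stl: "short_to_long s0 (canon s0 k s j) = canon s0 (Suc k) s0 0"
      using D 3 by (simp add: short_to_long_canon_all)
    have new: "new_bucket s0 (canon s0 k s j) =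
        (map (bucket s0 (Suc k) 0) [0..<s0], canon s0 (Suc k) s0 (Suc 0))"
      by (rule new_bucket_canon[OF stl]) (use D in auto)
    have s: "Suc s = 2 * s0"
      using 3 D by simp
    \<comment> \<open>Doubling preserves the number of buckets:
      \<open>(s + 1) * 2 ^ k = s0 * 2 ^ Suc k\<close>.\<close>
    have "s * 2 ^ k + j = Suc s * 2 ^ k"
      using 3 by simp
    then have total: "s * 2 ^ k + j = s0 * 2 ^ Suc k"
      unfolding s by simp
    \<comment> \<open>Here \<open>2 * s0\<close> and \<open>2 ^ Suc k\<close> are at most the number
      of buckets, so the temporary \<open>Suc s\<close> in register 1 and the doubled power
      fit.\<close>
    have "1 * 2 ^ Suc k \<le> s0 * 2 ^ Suc k" "2 * s0 \<le> s0 * 2 ^ Suc k"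
      using D(1) by (intro mult_right_mono; simp) simp
    then have "2 ^ Suc k < (2 ^ w :: nat)" "2 * s0 < 2 ^ w"
      using total m by linarith+
    then have w: "Suc s < 2 ^ w" "\<not> Suc s - s0 < s0" "s0 \<le> Suc s" "2 ^ k + 2 ^ k < (2 ^ w :: nat)"
      unfolding s by (simp_all add: mult_2)
    have mem: "represents w s0 (Suc k) s0 0
        (m[3 := 0, Suc 0 := Suc s, 9 := Suc s - s0, Suc 0 := s0, 2 := 2 ^ k + 2 ^ k])"
      using rep total m by (simp add: represents_def nth_list_update)
    have "halts w new_code
      (\<lambda>m' ys. represents w s0 (Suc k) s0 (Suc 0) m' \<and> ys = map (bucket s0 (Suc k) 0) [0..<s0]) (18 * s0 + 12)
      \<lparr>pc = 0, mem = m, inp = [], out = []\<rparr>"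
      apply (rule halts_step, simp add: new_code_defs, simp add: new_code_defs, simp add: D(1,2,4-20) 3(1) w exec_simps, simp, simp flip: numeral_2_eq_2)
      apply (rule halts_step, simp add: new_code_defs, simp add: new_code_defs, simp add: D(1,2,4-20) 3(1) w exec_simps, simp, simp flip: numeral_2_eq_2)
      apply (rule halts_step, simp add: new_code_defs, simp add: new_code_defs, simp add: D(1,2,4-20) 3(1) w exec_simps, simp, simp flip: numeral_2_eq_2)
      apply (rule halts_step, simp add: new_code_defs, simp add: new_code_defs, simp add: D(1,2,4-20) 3(1) w exec_simps, simp, simp flip: numeral_2_eq_2)
      apply (rule halts_step, simp add: new_code_defs, simp add: new_code_defs, simp add: D(1,2,4-20) 3(1) w exec_simps, simp, simp flip: numeral_2_eq_2)
      apply (rule halts_step, simp add: new_code_defs, simp add: new_code_defs, simp add: D(1,2,4-20) 3(1) w exec_simps, simp, simp flip: numeral_2_eq_2)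
      apply (rule halts_step, simp add: new_code_defs, simp add: new_code_defs, simp add: D(1,2,4-20) 3(1) w exec_simps, simp, simp flip: numeral_2_eq_2)
      by (rule halts_mono[OF halts_new_code_tail[OF mem]]) (use D total m in simp_all)
    then show ?thesis
      unfolding new by (intro exI conjI, rule_tac [2] halts_mono) (use D in auto)
  qed
qed

section \<open>Removing a bucket\<close>

lemma halts_free_code_tail:
  assumes rep: "represents w s0 k s (Suc j) m"
  shows "halts w free_code
    (\<lambda>m' ys. represents w s0 k s j m' \<and> ys = map (bucket s0 k j) [0..<s] @ [s * 2 ^ k + j]) (18 * s + 6)
    \<lparr>pc = 7, mem = m, inp = [], out = []\<rparr>"
proof -
  note D = representsD[OF rep]
  have j: "j < 2 ^ k" "j < 2 ^ w" "Suc (s * 2 ^ k + j) < 2 ^ w"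
    using D by simp_all
  \<comment> \<open>Registers 3 and 4 are decreased before the loop, so the final
    \<open>Write 4\<close> emits the discarded number \<open>s * 2 ^ k + j\<close>.\<close>
  let ?m = "m[3 := j, 4 := s * 2 ^ k + j, 7 := j, 8 := 0]"
  have "halts w free_code
      (\<lambda>m' ys. represents w s0 k s j m' \<and> ys = map (bucket s0 k j) [0..<s] @ [s * 2 ^ k + j])
      (2 + 18 * (s - 0)) \<lparr>pc = 11, mem = ?m, inp = [], out = []\<rparr>"
    (is "halts _ _ ?Q _ _")
  proof (rule halts_loop_code[OF _ _ _ _ _ _ _ _ _ _ _ D(2) j(1) D(19)])
    fix m' assume m': "length m' = 19" "\<And>i. i < 8 \<Longrightarrow> m' ! i = ?m ! i"
    have rep': "represents w s0 k s j m'"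
      using rep m' by (simp add: represents_def nth_list_update)
    note D' = representsD[OF this]
    show "halts w free_code ?Q 2
        \<lparr>pc = 11 + 18, mem = m', inp = [], out = [] @ map (bucket s0 k j) [0..<s]\<rparr>"
      apply (rule halts_step, simp add: free_code_defs, simp add: free_code_defs, simp add: D' exec_simps, simp, simp)
      by (rule halts_halt)
        (use rep' in \<open>simp_all add: free_code_def loop_code_def bucket_code_def\<close>)
  qed (use D in \<open>simp_all add: free_code_def loop_code_def bucket_code_def nth_list_update\<close>)
  then show ?thesis
    apply -
    apply (rule halts_step, simp add: free_code_defs, simp add: free_code_defs, simp add: D j exec_simps, simp, simp)
    apply (rule halts_step, simp add: free_code_defs, simp add: free_code_defs, simp add: D j exec_simps, simp, simp)
    apply (rule halts_step, simp add: free_code_defs, simp add: free_code_defs, simp add: D j exec_simps, simp, simp)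
    apply (rule halts_step, simp add: free_code_defs, simp add: free_code_defs, simp add: D j exec_simps, simp, simp)
    done
qed

lemma halts_free_code:
  assumes rep: "represents w s0 k s j m" and m: "s0 < s * 2 ^ k + j"
  shows "\<exists>k' s' j'. snd (free_bucket s0 (canon s0 k s j)) = canon s0 k' s' j' \<and>
    halts w free_code
      (\<lambda>m' ys. represents w s0 k' s' j' m' \<and> ys = fst (free_bucket s0 (canon s0 k s j))) (60 * s0)
      \<lparr>pc = 0, mem = m, inp = [], out = []\<rparr>"
proof -
  note D = representsD[OF rep]
  \<comment> \<open>The assumption \<open>m\<close> rules out the one remaining combination,
    \<open>j = 0\<close>, \<open>s = s0\<close>, \<open>k = 0\<close>, which is the initial
    state.\<close>
  consider j' where "j = Suc j'" | s' where "j = 0" "s = Suc s'" "s0 \<le> s'"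
    | k' where "j = 0" "s = s0" "k = Suc k'"
    using D m by (cases j; cases s; cases k) force+
  then show ?thesis
  proof cases
    case 1
    have free: "free_bucket s0 (canon s0 k s j) =
        (map (bucket s0 k j') [0..<s] @ [s * 2 ^ k + j'], canon s0 k s j')"
      using D 1 by (intro free_bucket_canon) (auto simp: long_to_short_canon_pos)
    have "halts w free_code
      (\<lambda>m' ys. represents w s0 k s j' m' \<and> ys = map (bucket s0 k j') [0..<s] @ [s * 2 ^ k + j'])
      (18 * s + 14) \<lparr>pc = 0, mem = m, inp = [], out = []\<rparr>"
      apply (rule halts_step, simp add: free_code_defs, simp add: free_code_defs, simp add: D 1 exec_simps, simp, simp)
      apply (rule halts_step, simp add: free_code_defs, simp add: free_code_defs, simp add: D 1 exec_simps, simp, simp)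
      by (rule halts_mono[OF halts_free_code_tail[OF rep[unfolded 1]]]) simp
    then show ?thesis
      unfolding free by (intro exI conjI, rule_tac [2] halts_mono) (use D in auto)
  next
    case 2
    \<comment> \<open>\<open>2 ^ k\<close> is written as a successor to match
      \<open>free_bucket_canon\<close>; the group to be lengthened is the last one.\<close>
    have lts: "long_to_short s0 (canon s0 k s j) = canon s0 k s' (Suc (2 ^ k - 1))"
      using D 2 by (simp add: long_to_short_canon_zero)
    have free: "free_bucket s0 (canon s0 k s j) =
        (map (bucket s0 k (2 ^ k - 1)) [0..<s'] @ [s' * 2 ^ k + (2 ^ k - 1)], canon s0 k s' (2 ^ k - 1))"
      using D 2 by (intro free_bucket_canon[OF lts]) auto
    have mem: "represents w s0 k s' (Suc (2 ^ k - 1)) (m[Suc 0 := s', 3 := 2 ^ k])"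
      using rep 2 by (simp add: represents_def nth_list_update algebra_simps)
    have s: "s0 < Suc s'" "Suc s' < 2 ^ w"
      using D 2 by simp_all
    have "halts w free_code
      (\<lambda>m' ys. represents w s0 k s' (2 ^ k - 1) m' \<and>
         ys = map (bucket s0 k (2 ^ k - 1)) [0..<s'] @ [s' * 2 ^ k + (2 ^ k - 1)])
      (18 * s' + 14) \<lparr>pc = 0, mem = m, inp = [], out = []\<rparr>"
      apply (rule halts_step, simp add: free_code_defs, simp add: free_code_defs, simp add: D 2(1,2) s exec_simps, simp, simp)
      apply (rule halts_step, simp add: free_code_defs, simp add: free_code_defs, simp add: D 2(1,2) s exec_simps, simp, simp)
      apply (rule halts_step, simp add: free_code_defs, simp add: free_code_defs, simp add: D 2(1,2) s exec_simps, simp, simp)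
      apply (rule halts_step, simp add: free_code_defs, simp add: free_code_defs, simp add: D 2(1,2) s exec_simps, simp, simp)
      by (rule halts_mono[OF halts_free_code_tail[OF mem, simplified]]) simp
    then show ?thesis
      unfolding free by (intro exI conjI, rule_tac [2] halts_mono) (use D 2 in auto)
  next
    case 3
    define s' where "s' = 2 * s0 - 1"
    have s': "2 * s0 = Suc s'" "s0 + s0 = Suc s'"
      using D(1) by (simp_all add: s'_def)
    have lts: "long_to_short s0 (canon s0 k s j) = canon s0 k' s' (Suc (2 ^ k' - 1))"
      using D 3 by (simp add: long_to_short_canon_zero s'_def)
    have free: "free_bucket s0 (canon s0 k s j) =
        (map (bucket s0 k' (2 ^ k' - 1)) [0..<s'] @ [s' * 2 ^ k' + (2 ^ k' - 1)], canon s0 k' s' (2 ^ k' - 1))"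
      using D 3 s' by (intro free_bucket_canon[OF lts]) auto
    have "s * 2 ^ k = 2 * s0 * 2 ^ k'"
      using 3 by simp
    then have total: "s * 2 ^ k = s' * 2 ^ k' + 2 ^ k'"
      unfolding s' by simp
    have mem: "represents w s0 k' s' (Suc (2 ^ k' - 1)) (m[Suc 0 := Suc s', 2 := 2 ^ k', Suc 0 := s', 3 := 2 ^ k'])"
      using rep 3(1) s' total D(1) unfolding represents_def by (simp add: nth_list_update)
    \<comment> \<open>As \<open>k\<close> is positive, \<open>2 * s0\<close> is at most the number
      of buckets, so \<open>s0 + s0\<close> does not overflow.\<close>
    have "2 * s0 \<le> s0 * 2 ^ k"
      using 3 by simp
    then have w: "Suc s' < 2 ^ w" "2 ^ k' < (2 ^ w :: nat)"
      using D(5,16,17) 3 s' by simp_all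
    have shr: "alu_sem w Shr (2 * 2 ^ k') (Suc 0) = 2 ^ k'"
      by (simp add: alu_sem.simps drop_bit_Suc)
    have "halts w free_code
      (\<lambda>m' ys. represents w s0 k' s' (2 ^ k' - 1) m' \<and>
         ys = map (bucket s0 k' (2 ^ k' - 1)) [0..<s'] @ [s' * 2 ^ k' + (2 ^ k' - 1)])
      (18 * s' + 14) \<lparr>pc = 0, mem = m, inp = [], out = []\<rparr>"
      apply (rule halts_step, simp add: free_code_defs, simp add: free_code_defs, simp add: D 3 s' w shr exec_simps, simp, simp)
      apply (rule halts_step, simp add: free_code_defs, simp add: free_code_defs, simp add: D 3 s' w shr exec_simps, simp, simp)
      apply (rule halts_step, simp add: free_code_defs, simp add: free_code_defs, simp add: D 3 s' w shr exec_simps, simp, simp)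
      apply (rule halts_step, simp add: free_code_defs, simp add: free_code_defs, simp add: D 3 s' w shr exec_simps, simp, simp)
      apply (rule halts_step, simp add: free_code_defs, simp add: free_code_defs, simp add: D 3 s' w shr exec_simps, simp, simp)
      apply (rule halts_step, simp add: free_code_defs, simp add: free_code_defs, simp add: D 3 s' w shr exec_simps, simp, simp)
      by (rule halts_mono[OF halts_free_code_tail[OF mem, simplified]]) simp
    then show ?thesis
      unfolding free by (intro exI conjI, rule_tac [2] halts_mono) (use D s' in auto)
  qed
qed

section \<open>Serving a sequence of operations\<close>

definition impl :: rm_impl where
  "impl = \<lparr>init_prog = init_code, num_prog = num_code, find_prog = find_code,
     new_prog = new_code, free_prog = free_code\<rparr>"

lemma halts_prog_of:
  assumes rep: "represents w s0 k s j m" and adm: "admissible w s0 x (canon s0 k s j)"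
  shows "\<exists>k' s' j'. next_state s0 x (canon s0 k s j) = canon s0 k' s' j' \<and>
    halts w (prog_of impl x)
      (\<lambda>m' ys. represents w s0 k' s' j' m' \<and> ys = result s0 x (canon s0 k s j)) (time_bound 60 s0 x)
      \<lparr>pc = 0, mem = m, inp = args x, out = []\<rparr>"
proof -
  have num: "num_buckets (canon s0 k s j) = s * 2 ^ k + j"
    using representsD(4)[OF rep] by (rule num_buckets_canon)
  show ?thesis
  proof (cases x)
    case Num_Buckets
    then show ?thesis
      using halts_mono[OF halts_num_code[OF rep], of 60] num
      by (intro exI[of _ k] exI[of _ s] exI[of _ j]) (simp add: impl_def)
  next
    case (Find_Bucket a b)
    then show ?thesis
      using halts_mono[OF halts_find_code[OF rep], of a b 60] adm
      by (intro exI[of _ k] exI[of _ s] exI[of _ j]) (simp add: impl_def)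
  next
    case New_Bucket
    then show ?thesis
      using halts_new_code[OF rep] adm num by (simp add: impl_def)
  next
    case Free_Bucket
    then show ?thesis
      using halts_free_code[OF rep] adm num by (simp add: impl_def)
  qed
qed

lemma serves_canon: "represents w s0 k s j m \<Longrightarrow> serves impl w s0 60 m (canon s0 k s j) ops"
proof (induction ops arbitrary: k s j m)
  case (Cons x ops)
  show ?case
    unfolding serves.simps
  proof
    assume "admissible w s0 x (canon s0 k s j)"
    from halts_prog_of[OF Cons.prems this] obtain k' s' j' where
      next_eq: "next_state s0 x (canon s0 k s j) = canon s0 k' s' j'" and
      "halts w (prog_of impl x)
        (\<lambda>m' ys. represents w s0 k' s' j' m' \<and> ys = result s0 x (canon s0 k s j)) (time_bound 60 s0 x)
        \<lparr>pc = 0, mem = m, inp = args x, out = []\<rparr>"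
      by blast
    from halts_computes[OF this(2)] obtain t m' where
      "t \<le> time_bound 60 s0 x" "computes w (prog_of impl x) m (args x) t m' (result s0 x (canon s0 k s j))"
      "represents w s0 k' s' j' m'"
      by blast
    then show "\<exists>t m'. t \<le> time_bound 60 s0 x \<and>
        computes w (prog_of impl x) m (args x) t m' (result s0 x (canon s0 k s j)) \<and>
        serves impl w s0 60 m' (next_state s0 x (canon s0 k s j)) ops"
      using Cons.IH next_eq by (intro exI[of _ t] exI[of _ m']) simp
  qed
qed simp

theorem theorem2:
  shows "\<exists>(I :: rm_impl) (M :: nat) (c :: nat).
    \<forall>(s0 :: nat) (w :: nat) (m0 :: nat list).
      1 < s0 \<and> s0 < 2 ^ w \<and> length m0 = M \<and> (\<forall>x\<in>set m0. x < 2 ^ w) \<longrightarrow>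
      (\<exists>t m. t \<le> c \<and> computes w (init_prog I) m0 [s0] t m [] \<and>
         (\<forall>ops. serves I w s0 c m (rm_init s0) ops))"
\<comment> \<open>Memory consists of registers 0 to 18. The constant 60 covers the 27 steps of a
  query and, as \<open>s < 2 * s0\<close>, the at most \<open>18 * s + 14\<close> steps of an
  update, where \<open>s\<close> is the parameter after it.\<close>
proof (rule exI[of _ impl], rule exI[of _ 19], rule exI[of _ 60], intro allI impI)
  fix s0 w :: nat and m0 :: "nat list"
  assume "1 < s0 \<and> s0 < 2 ^ w \<and> length m0 = 19 \<and> (\<forall>x\<in>set m0. x < 2 ^ w)"
  then have "halts w init_code (\<lambda>m' ys. represents w s0 0 s0 0 m' \<and> ys = []) 8
      \<lparr>pc = 0, mem = m0, inp = [s0], out = []\<rparr>"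
    by (intro halts_init_code) auto
  from halts_computes[OF this] obtain t m where
    "t \<le> 8" "computes w init_code m0 [s0] t m []" "represents w s0 0 s0 0 m"
    by blast
  then show "\<exists>t m. t \<le> 60 \<and> computes w (init_prog impl) m0 [s0] t m [] \<and>
      (\<forall>ops. serves impl w s0 60 m (rm_init s0) ops)"
    using serves_canon[of w s0 0 s0 0 m]
    by (intro exI[of _ t] exI[of _ m]) (simp add: impl_def canon_init)
qed

end
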